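(* Consider the integrodifference equation $(I_0)$ and its collocation discretizations $(I_n)$, $n\in\mathbb{N}$, with the standing assumptions described in the context (in particular time-invariant $Z_t\equiv Z$, $U_t\equiv U$, and $\mathbb{I}$ unbounded above). Let $\rho>1$ and suppose that for all $\tau\in\mathbb{I}$ $$\lim_{s\to\infty}\prod_{l=\tau}^{\tau+s-1}pa_l=0,\qquad R:=R_\tau:=p\lim_{t\to\infty}\sum_{l_1=\tau}^{t-1}b_{l_1}\prod_{l_2=l_1+1}^{t-1}pa_{l_2}\in(0,\infty),\qquad pb_\tau\le\rho R(1-pa_\tau)$$ (the value $R_\tau$ is independent of $\tau$), and put $\mathcal{A}:=\{(\tau,u)\in\mathcal{U}:\|u\|\le\rho R\}$. If each $(I_n)$ is strongly $\mathcal{A}$-asymptotically compact with a compact $K_n\subseteq U$, $n\in\mathbb{N}_0$, then its forward limit set $\omega_{\mathcal{A},n}^+\subseteq K_n$ is nonempty, compact and forward attracts $\mathcal{A}$. If moreover $K:=\bigcup_{n\in\mathbb{N}_0}K_n$ is bounded, $\mathscr{F}_t:U\to U$ maps bounded subsets of $U$ into bounded sets uniformly in $t\in\mathbb{I}$ and (i) $\omega_{\mathcal{A},0}^+$ attracts $K$ uniformly in $\tau\in\mathbb{I}$, i.e. $\lim_{s\to\infty}\sup_{\tau\in\mathbb{I}}\operatorname{dist}\bigl(\varphi^0(\tau+s;\tau,K),\omega_{\mathcal{A},0}^+\bigr)=0$, (ii) for every sequence $((s_k,\tau_k))_{k\in\mathbb{N}}$ in $\mathbb{N}\times\mathbb{I}$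 with $\tau_k\to\infty$ as $k\to\infty$ one has $\lim_{k\to\infty}\operatorname{dist}\bigl(\varphi^n(\tau_k+s_k;\tau_k,K_n),K_n\bigr)=0$ for all $n\in\mathbb{N}_0$, (iii) for every $t\in\mathbb{I}$ and $r>0$ there is a function $\lambda_t:\Omega\times\Omega\to\mathbb{R}_+$ (possibly depending on $r$), measurable in the second argument, with $|f_t(x,y,z)-f_t(x,y,\bar z)|\le\lambda_t(x,y)|z-\bar z|$ for all $x,y\in\Omega$, $z,\bar z\in Z\cap\bar B_r(0)$, where $\ell_t(r):=\sup_{x\in\Omega}\int_\Omega\lambda_t(x,y)\,dy<\infty$, and $\ell(r):=\sup_{t\in\mathbb{I}}\ell_t(r)<\infty$ for all $r>0$, (iv) the collocation discretizations $(I_n)$, $n\in\mathbb{N}$, are convergent hold, then $\lim_{n\to\infty}\operatorname{dist}(\omega_{\mathcal{A},n}^+,\omega_{\mathcal{A},0}^+)=0$.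
   Context: Setting. $\mathbb{I}$ is a discrete interval (intersection of a real interval with $\mathbb{Z}$) unbounded above, $\mathbb{N}=\{1,2,\dots\}$, $\mathbb{N}_0=\mathbb{N}\cup\{0\}$, $\mathbb{R}_+=[0,\infty)$. $\Omega\subset\mathbb{R}^\kappa$ is nonempty and compact; $C_d$ is the space of continuous functions $u:\Omega\to\mathbb{R}^d$ with $\|u\|=\max_{x\in\Omega}|u(x)|$. $Z\subseteq\mathbb{R}^d$ is nonempty and closed, $U:=\{u\in C_d:u(x)\in Z\ \forall x\in\Omega\}$, $\mathcal{U}:=\mathbb{I}\times U$. For $t\in\mathbb{I}$, $f_t:\Omega\times\Omega\times Z\to\mathbb{R}^d$ is continuous and $\mathscr{F}_t:U\to C_d$, $\mathscr{F}_t(u):=\int_\Omega f_t(\cdot,y,u(y))\,dy$. $\bar B_r(0)$ is the closed ball of radius $r$ about $0$. Empty products equal $1$. Assumptions, for all $t\in\mathbb{I}$: - (growth) there are $\alpha_t,\beta_t:\Omega^2\to\mathbb{R}_+$, measurable in the second argument, with $a_t:=\sup_{x\in\Omega}\int_\Omega\alpha_t(x,y)\,dy<\infty$, $b_t:=\sup_{x\in\Omega}\int_\Omega\beta_t(x,y)\,dy<\infty$ and $|f_t(x,y,z)|\le\beta_t(x,y)+\alpha_t(x,y)|z|$ for all $x,y\in\Omega$, $z\in Z$; - (invariance) $\int_\Omega f_t(x,y,u(y))\,dy\in Z$ for all $x\in\Omega$, $u\in U$ (so $\mathscr{F}_t(U)\subseteq U$); - (projections) for each $n\in\mathbb{N}$,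 $X_n\subset C_1$ is a finite-dimensional subspace of the space $C_1$ of continuous real functions on $\Omega$, $\pi_n$ is a bounded linear projection of $C_1$ onto $X_n$, $\Pi_n$ acts on $C_d$ by $\Pi_n(u_j)_{j=1}^d=(\pi_nu_j)_{j=1}^d$; $\Pi_0:=\mathrm{id}_{C_d}$; - (stability) $p:=\sup_{n\in\mathbb{N}}\|\Pi_n\|\in[1,\infty)$; - $\Pi_nU\subseteq U$ for all $n\in\mathbb{N}$. For $n\in\mathbb{N}_0$, $(I_n)$ is the equation $u_{t+1}=\mathscr{F}_t^n(u_t)$ with $\mathscr{F}_t^n:=\Pi_n\mathscr{F}_t$ on $U$; its general solution is $\varphi^n(\tau;\tau,u)=u$, $\varphi^n(t;\tau,u)=\mathscr{F}^n_{t-1}\circ\cdots\circ\mathscr{F}^n_\tau(u)$ for $\tau<t$, $u\in U$. For $\mathcal{A}\subseteq\mathcal{U}$, $\mathcal{A}(t)=\{u:(t,u)\in\mathcal{A}\}$. $\operatorname{dist}(A,B)=\sup_{a\in A}\inf_{b\in B}\|a-b\|$. "$\mathscr{F}_t$ maps bounded subsets of $U$ into bounded sets uniformly in $t$": for every $r>0$ there is $r'>0$ with $\mathscr{F}_t(U\cap\bar B_r(0))\subseteq\bar B_{r'}(0)$ for all $t\in\mathbb{I}$. Convergent: there is $\Gamma:\mathbb{R}_+\to\mathbb{R}_+$ with $\lim_{\rho\searrow0}\Gamma(\rho)=0$ such that for every bounded $B\subseteq U$ there is $C(B)\ge0$ with $\sup_{u\in B}\|\mathscr{F}_t^n(u)-\mathscr{F}_t(u)\|\le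 C(B)\Gamma(\tfrac1n)$ for all $n\in\mathbb{N}$, $t\in\mathbb{I}$. $(I_n)$ is strongly $\mathcal{A}$-asymptotically compact with $K_n$ if $K_n\subseteq U$ is nonempty, compact and every sequence $((s_k,\tau_k))_{k\in\mathbb{N}}$ in $\mathbb{N}\times\mathbb{I}$ with $s_k\to\infty$, $\tau_k\to\infty$ satisfies $\lim_{k\to\infty}\operatorname{dist}(\varphi^n(\tau_k+s_k;\tau_k,\mathcal{A}(\tau_k)),K_n)=0$. Forward limit set of $(I_n)$: $\Omega_{\mathcal{A},n}(\tau):=\bigcap_{0\le s}\overline{\bigcup_{s\le t}\varphi^n(\tau+t;\tau,\mathcal{A}(\tau))}$, $\omega_{\mathcal{A},n}^+:=\overline{\bigcup_{\tau\in\mathbb{I}}\Omega_{\mathcal{A},n}(\tau)}$. It forward attracts $\mathcal{A}$ if $\lim_{s\to\infty}\operatorname{dist}(\varphi^n(\tau+s;\tau,\mathcal{A}(\tau)),\omega_{\mathcal{A},n}^+)=0$ for all $\tau\in\mathbb{I}$. *)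

theory Defs
  imports "HOL-Analysis.Analysis"
begin

definition discrete_interval :: "int set \<Rightarrow> bool" where
  "discrete_interval I \<longleftrightarrow> (\<exists>J::real set. is_interval J \<and> I = {t. real_of_int t \<in> J})"

subsection \<open>The space of continuous functions on a compact set\<close>

text \<open>Functions on \<^term>\<open>\<Omega>\<close> are represented by extensional functions (fixed to be
  \<^const>\<open>undefined\<close> off \<^term>\<open>\<Omega>\<close>), so that equality is equality on \<^term>\<open>\<Omega>\<close>;
  see the two lemmas below.\<close>

definition cont_space :: "'a::topological_space set \<Rightarrow> ('a \<Rightarrow> 'b::metric_space) metric" where
  "cont_space \<Omega> = cfunspace (top_of_set \<Omega>) euclidean_metric"

definition sup_norm :: "'a set \<Rightarrow> ('a \<Rightarrow> 'b::real_normed_vector) \<Rightarrow> real" where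
  "sup_norm \<Omega> u = (SUP x\<in>\<Omega>. norm (u x))"

lemma mspace_cont_space:
  fixes \<Omega> :: "'a::topological_space set"
  assumes "compact \<Omega>"
  shows "mspace (cont_space \<Omega>) =
    {u :: 'a \<Rightarrow> 'b::metric_space. continuous_on \<Omega> u \<and> u \<in> extensional \<Omega>}"
proof -
  have "Metric_space.mbounded UNIV dist (u ` \<Omega>)" if "continuous_on \<Omega> u"
    for u :: "'a \<Rightarrow> 'b"
    using compact_imp_bounded[OF compact_continuous_image[OF that assms]]
    by simp
  then show ?thesis
    by (auto simp: cont_space_def)
qed

lemma mdist_cont_space:
  fixes u v :: "'a::topological_space \<Rightarrow> 'b::real_normed_vector"
  assumes "\<Omega> \<noteq> {}" "u \<in> mspace (cont_space \<Omega>)" "v \<in> mspace (cont_space \<Omega>)"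
  shows "mdist (cont_space \<Omega>) u v = sup_norm \<Omega> (\<lambda>x. u x - v x)"
proof -
  have "u \<in> Metric_space.fspace UNIV dist \<Omega>" "v \<in> Metric_space.fspace UNIV dist \<Omega>"
    using assms by (auto simp: cont_space_def Met_TC.fspace_def)
  then show ?thesis
    using assms(1)
    by (simp add: cont_space_def mdist_cfunspace_eq_mdist_funspace
        Met_TC.fdist_def sup_norm_def dist_norm)
qed

definition norm_bounded :: "'a set \<Rightarrow> ('a \<Rightarrow> 'b::real_normed_vector) set \<Rightarrow> bool" where
  "norm_bounded \<Omega> B \<longleftrightarrow> (\<exists>r. \<forall>u\<in>B. sup_norm \<Omega> u \<le> r)"

definition state_set ::
    "'a::topological_space set \<Rightarrow> 'b::metric_space set \<Rightarrow> ('a \<Rightarrow> 'b) set" where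
  "state_set \<Omega> Z = {u \<in> mspace (cont_space \<Omega>). \<forall>x\<in>\<Omega>. u x \<in> Z}"

subsection \<open>Integral operators and collocation projections\<close>

definition nonneg_kernel :: "(real^'k) set \<Rightarrow> (real^'k \<Rightarrow> real^'k \<Rightarrow> real) \<Rightarrow> bool" where
  "nonneg_kernel \<Omega> k \<longleftrightarrow>
     (\<forall>x\<in>\<Omega>. (\<forall>y\<in>\<Omega>. 0 \<le> k x y) \<and> k x \<in> borel_measurable (lebesgue_on \<Omega>))"

definition kernel_sup :: "(real^'k) set \<Rightarrow> (real^'k \<Rightarrow> real^'k \<Rightarrow> real) \<Rightarrow> ennreal" where
  "kernel_sup \<Omega> k = (SUP x\<in>\<Omega>. \<integral>\<^sup>+ y. ennreal (k x y) \<partial>lebesgue_on \<Omega>)"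

definition integral_op ::
    "(real^'k) set \<Rightarrow> (real^'k \<Rightarrow> real^'k \<Rightarrow> real^'d \<Rightarrow> real^'d)
      \<Rightarrow> (real^'k \<Rightarrow> real^'d) \<Rightarrow> (real^'k \<Rightarrow> real^'d)" where
  "integral_op \<Omega> g u = (\<lambda>x\<in>\<Omega>. LINT y|lebesgue_on \<Omega>. g x y (u y))"

definition fin_dim_subspace :: "'a::topological_space set \<Rightarrow> ('a \<Rightarrow> real) set \<Rightarrow> bool" where
  "fin_dim_subspace \<Omega> V \<longleftrightarrow>
     V \<subseteq> mspace (cont_space \<Omega>) \<and> (\<lambda>x\<in>\<Omega>. 0) \<in> V \<and>
     (\<forall>v\<in>V. \<forall>w\<in>V. (\<lambda>x\<in>\<Omega>. v x + w x) \<in> V) \<and>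
     (\<forall>c. \<forall>v\<in>V. (\<lambda>x\<in>\<Omega>. c * v x) \<in> V) \<and>
     (\<exists>B. finite B \<and> B \<subseteq> V \<and> (\<forall>v\<in>V. \<exists>c. v = (\<lambda>x\<in>\<Omega>. \<Sum>w\<in>B. c w * w x)))"

definition bounded_projection ::
    "'a::topological_space set \<Rightarrow> ('a \<Rightarrow> real) set \<Rightarrow> (('a \<Rightarrow> real) \<Rightarrow> ('a \<Rightarrow> real)) \<Rightarrow> bool" where
  "bounded_projection \<Omega> X P \<longleftrightarrow>
     (let C = mspace (cont_space \<Omega>) in
       (\<forall>v\<in>C. \<forall>w\<in>C. P (\<lambda>x\<in>\<Omega>. v x + w x) = (\<lambda>x\<in>\<Omega>. P v x + P w x)) \<and>
       (\<forall>c. \<forall>v\<in>C. P (\<lambda>x\<in>\<Omega>. c * v x) = (\<lambda>x\<in>\<Omega>. c * P v x)) \<and>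
       (\<exists>M. \<forall>v\<in>C. sup_norm \<Omega> (P v) \<le> M * sup_norm \<Omega> v) \<and>
       P ` C = X \<and> (\<forall>v\<in>C. P (P v) = P v))"

definition vec_projection ::
    "(real^'k) set \<Rightarrow> (nat \<Rightarrow> (real^'k \<Rightarrow> real) \<Rightarrow> (real^'k \<Rightarrow> real)) \<Rightarrow> nat
      \<Rightarrow> (real^'k \<Rightarrow> real^'d) \<Rightarrow> (real^'k \<Rightarrow> real^'d)" where
  "vec_projection \<Omega> \<pi> n u =
     (if n = 0 then u else (\<lambda>x\<in>\<Omega>. \<chi> j. \<pi> n (\<lambda>y\<in>\<Omega>. u y $ j) x))"

definition op_norm ::
    "'a::topological_space set \<Rightarrow> (('a \<Rightarrow> 'b::real_normed_vector) \<Rightarrow> ('a \<Rightarrow> 'b)) \<Rightarrow> ennreal" where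
  "op_norm \<Omega> L = (SUP u\<in>{u \<in> mspace (cont_space \<Omega>). sup_norm \<Omega> u \<le> 1}.
                      ennreal (sup_norm \<Omega> (L u)))"

definition collocation_op ::
    "(real^'k) set \<Rightarrow> (int \<Rightarrow> real^'k \<Rightarrow> real^'k \<Rightarrow> real^'d \<Rightarrow> real^'d)
      \<Rightarrow> (nat \<Rightarrow> (real^'k \<Rightarrow> real) \<Rightarrow> (real^'k \<Rightarrow> real))
      \<Rightarrow> nat \<Rightarrow> int \<Rightarrow> (real^'k \<Rightarrow> real^'d) \<Rightarrow> (real^'k \<Rightarrow> real^'d)" where
  "collocation_op \<Omega> f \<pi> n t u = vec_projection \<Omega> \<pi> n (integral_op \<Omega> (f t) u)"

definition convergent_discretization ::
    "'a::topological_space set \<Rightarrow> int set \<Rightarrow> ('a \<Rightarrow> 'b::real_normed_vector) set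
      \<Rightarrow> (nat \<Rightarrow> int \<Rightarrow> ('a \<Rightarrow> 'b) \<Rightarrow> ('a \<Rightarrow> 'b)) \<Rightarrow> bool" where
  "convergent_discretization \<Omega> I U F \<longleftrightarrow>
     (\<exists>\<Gamma>::real \<Rightarrow> real. (\<forall>\<rho>\<ge>0. 0 \<le> \<Gamma> \<rho>) \<and> (\<Gamma> \<longlongrightarrow> 0) (at_right 0) \<and>
        (\<forall>B. B \<subseteq> U \<and> norm_bounded \<Omega> B \<longrightarrow>
           (\<exists>C\<ge>0. \<forall>n\<ge>1. \<forall>t\<in>I. \<forall>u\<in>B.
              mdist (cont_space \<Omega>) (F n t u) (F 0 t u) \<le> C * \<Gamma> (1 / real n))))"

subsection \<open>Nonautonomous difference equations\<close>

primrec iterate_steps :: "(int \<Rightarrow> 's \<Rightarrow> 's) \<Rightarrow> int \<Rightarrow> nat \<Rightarrow> 's \<Rightarrow> 's" where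
  "iterate_steps G \<tau> 0 u = u"
| "iterate_steps G \<tau> (Suc s) u = G (\<tau> + int s) (iterate_steps G \<tau> s u)"

text \<open>The general solution is only meaningful for \<^prop>\<open>\<tau> \<le> t\<close>.\<close>

definition general_solution :: "(int \<Rightarrow> 's \<Rightarrow> 's) \<Rightarrow> int \<Rightarrow> int \<Rightarrow> 's \<Rightarrow> 's" where
  "general_solution G t \<tau> u = iterate_steps G \<tau> (nat (t - \<tau>)) u"

text \<open>The Hausdorff semidistance takes values in \<^typ>\<open>ennreal\<close>, so that the supremum and
  infimum are always the genuine ones (supremum over the empty set \<^term>\<open>0\<close>, infimum over
  the empty set \<^term>\<open>\<infinity>\<close>).\<close>

definition semidist :: "'s metric \<Rightarrow> 's set \<Rightarrow> 's set \<Rightarrow> ennreal" where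
  "semidist m A B = (SUP a\<in>A. INF b\<in>B. ennreal (mdist m a b))"

text \<open>A nonautonomous set is a set of pairs; its fibre at \<^term>\<open>\<tau>\<close> is \<^term>\<open>\<A> `` {\<tau>}\<close>.\<close>

definition strongly_asymptotically_compact ::
    "'s metric \<Rightarrow> int set \<Rightarrow> 's set \<Rightarrow> (int \<Rightarrow> 's \<Rightarrow> 's) \<Rightarrow> (int \<times> 's) set \<Rightarrow> 's set \<Rightarrow> bool" where
  "strongly_asymptotically_compact m I U G \<A> K \<longleftrightarrow>
     K \<subseteq> U \<and> K \<noteq> {} \<and> compactin (mtopology_of m) K \<and>
     (\<forall>s::nat \<Rightarrow> nat. \<forall>\<tau>::nat \<Rightarrow> int.
        (\<forall>k. 1 \<le> s k \<and> \<tau> k \<in> I) \<and> filterlim s at_top sequentially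
          \<and> filterlim \<tau> at_top sequentially \<longrightarrow>
        (\<lambda>k. semidist m (general_solution G (\<tau> k + int (s k)) (\<tau> k) ` (\<A> `` {\<tau> k})) K)
          \<longlonglongrightarrow> 0)"

definition fibre_limit_set ::
    "'s metric \<Rightarrow> (int \<Rightarrow> 's \<Rightarrow> 's) \<Rightarrow> (int \<times> 's) set \<Rightarrow> int \<Rightarrow> 's set" where
  "fibre_limit_set m G \<A> \<tau> =
     (\<Inter>s::nat. mtopology_of m closure_of
        (\<Union>t\<in>{s..}. general_solution G (\<tau> + int t) \<tau> ` (\<A> `` {\<tau>})))"

definition forward_limit_set ::
    "'s metric \<Rightarrow> int set \<Rightarrow> (int \<Rightarrow> 's \<Rightarrow> 's) \<Rightarrow> (int \<times> 's) set \<Rightarrow> 's set" where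
  "forward_limit_set m I G \<A> = mtopology_of m closure_of (\<Union>\<tau>\<in>I. fibre_limit_set m G \<A> \<tau>)"

definition forward_attracts ::
    "'s metric \<Rightarrow> int set \<Rightarrow> (int \<Rightarrow> 's \<Rightarrow> 's) \<Rightarrow> 's set \<Rightarrow> (int \<times> 's) set \<Rightarrow> bool" where
  "forward_attracts m I G W \<A> \<longleftrightarrow>
     (\<forall>\<tau>\<in>I. (\<lambda>s::nat. semidist m (general_solution G (\<tau> + int s) \<tau> ` (\<A> `` {\<tau>})) W)
        \<longlonglongrightarrow> 0)"

end

theory Submission
  imports Defs
begin

text \<open>
  The conclusions rest on a fact about difference equations in a metric space. Let
  \<open>V\<close> be a set that all right-hand sides leave invariant, and let \<open>K\<close> be a compact set that
  attracts the orbits of \<open>V\<close> when both the initial time and the elapsed time tend to infinity.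
  Since the first half of an orbit segment stays in \<open>V\<close>, the second half starts in \<open>V\<close> at a
  late time; so \<open>K\<close> also attracts \<open>V\<close> from each fixed initial time
  (\<open>strongly_asymptotically_compact_attracts\<close>). Compactness then gives the usual properties
  of omega-limit sets (\<open>limit_set_subset_compact\<close>, \<open>limit_set_attracts\<close>,
  \<open>forward_limit_set_properties\<close>).

  For the convergence of the limit sets, write a late orbit point of the discretized equation as
  the result of a fixed number \<open>T\<close> of steps from an earlier orbit point, which lies close to
  \<open>K n\<close>. Replacing that earlier point by a point of \<open>K n\<close> and the discretized equation by the
  original one changes the result little, because a consistent and locally Lipschitz one-step
  method has small global error over \<open>T\<close> steps (\<open>iterate_steps_close\<close>). For \<open>T\<close> large the
  original equation carries all of the sets \<open>K n\<close> close to its own limit set, so the limit sets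
  of the discretizations are close to it as well (\<open>forward_limit_set_perturbation\<close>).

  For the integrodifference equation, the growth condition and the operator norm \<open>p\<close> give
  \<open>sup_norm \<Omega> (F n t u) \<le> p * b t + p * a t * sup_norm \<Omega> u\<close>. The limit \<open>R\<close> of the associated
  scalar recursion does not depend on the initial time (\<open>limit_radius_step\<close>), so \<open>\<A>\<close> has the
  constant fibre \<open>V\<close> of states of norm at most \<open>\<rho> * R\<close>. The absorption inequality makes \<open>V\<close>
  invariant, and \<open>V\<close> is nonempty because every orbit eventually has norm below \<open>\<rho> * R\<close>
  (\<open>affine_recursion_bound\<close>).
\<close>

section \<open>The Hausdorff semidistance\<close>

lemma semidist_lessD:
  assumes "semidist m A B < ennreal e" "x \<in> A"
  shows "\<exists>y\<in>B. mdist m x y < e"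
proof -
  have "(INF y\<in>B. ennreal (mdist m x y)) \<le> semidist m A B"
    unfolding semidist_def by (rule SUP_upper[OF assms(2)])
  then have "(INF y\<in>B. ennreal (mdist m x y)) < ennreal e"
    using assms(1) by (rule le_less_trans)
  then show ?thesis
    by (auto simp: INF_less_iff ennreal_less_iff)
qed

lemma semidist_leI:
  assumes "\<And>x. x \<in> A \<Longrightarrow> \<exists>y\<in>B. mdist m x y \<le> e"
  shows "semidist m A B \<le> ennreal e"
  unfolding semidist_def
proof (rule SUP_least)
  fix x assume "x \<in> A"
  then obtain y where "y \<in> B" "mdist m x y \<le> e" using assms by blast
  then show "(INF y\<in>B. ennreal (mdist m x y)) \<le> ennreal e"
    by (intro INF_lower2[of y]) (auto intro: ennreal_leI)
qed

lemma semidist_mono_left: "A \<subseteq> A' \<Longrightarrow> semidist m A B \<le> semidist m A' B"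
  unfolding semidist_def by (rule SUP_subset_mono) auto

text \<open>The semidistance is an extended number, possibly infinite; with real tolerances the triangle
  inequality of the metric becomes directly applicable.\<close>

lemma semidist_tendsto_0_iff:
  "((\<lambda>k. semidist m (A k) (B k)) \<longlongrightarrow> 0) F \<longleftrightarrow>
     (\<forall>e>0. \<forall>\<^sub>F k in F. \<forall>x\<in>A k. \<exists>y\<in>B k. mdist m x y < e)"
proof
  assume lim: "((\<lambda>k. semidist m (A k) (B k)) \<longlongrightarrow> 0) F"
  show "\<forall>e>0. \<forall>\<^sub>F k in F. \<forall>x\<in>A k. \<exists>y\<in>B k. mdist m x y < e"
  proof (intro allI impI)
    fix e :: real assume "e > 0"
    then have "\<forall>\<^sub>F k in F. semidist m (A k) (B k) < ennreal e"
      using order_tendstoD(2)[OF lim] by simp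
    then show "\<forall>\<^sub>F k in F. \<forall>x\<in>A k. \<exists>y\<in>B k. mdist m x y < e"
      by (rule eventually_mono) (intro ballI semidist_lessD)
  qed
next
  assume small: "\<forall>e>0. \<forall>\<^sub>F k in F. \<forall>x\<in>A k. \<exists>y\<in>B k. mdist m x y < e"
  show "((\<lambda>k. semidist m (A k) (B k)) \<longlongrightarrow> 0) F"
  proof (rule order_tendstoI)
    fix c :: ennreal assume "0 < c"
    then obtain d where d: "0 < d" "d < c" using dense by blast
    from d(2) have "d < top" using top.not_eq_extremum by fastforce
    then obtain e where e: "d = ennreal e" "0 \<le> e"
      using less_top_ennreal by blast
    with d(1) have "e > 0" by simp
    then have "\<forall>\<^sub>F k in F. \<forall>x\<in>A k. \<exists>y\<in>B k. mdist m x y < e"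
      using small by blast
    then show "\<forall>\<^sub>F k in F. semidist m (A k) (B k) < c"
    proof (rule eventually_mono)
      fix k assume "\<forall>x\<in>A k. \<exists>y\<in>B k. mdist m x y < e"
      then have "semidist m (A k) (B k) \<le> ennreal e"
        by (intro semidist_leI) (meson less_imp_le)
      then show "semidist m (A k) (B k) < c" using d e by simp
    qed
  qed simp
qed

lemma semidist_tendsto_0D:
  assumes "((\<lambda>k. semidist m (A k) (B k)) \<longlongrightarrow> 0) F" "e > 0"
  shows "\<forall>\<^sub>F k in F. \<forall>x\<in>A k. \<exists>y\<in>B k. mdist m x y < e"
  using assms semidist_tendsto_0_iff by blast

section \<open>Limit sets in metric spaces\<close>

lemma in_closure_of_metric:
  "x \<in> mtopology_of m closure_of S \<longleftrightarrow>
     x \<in> mspace m \<and> (\<forall>r>0. \<exists>y\<in>S. y \<in> mspace m \<and> mdist m x y < r)"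
proof -
  interpret Metric_space "mspace m" "mdist m" by (rule Metric_space_mspace_mdist)
  show ?thesis
    unfolding mtopology_of_def metric_closure_of by auto
qed

lemma compactin_closure_subset:
  assumes "compactin (mtopology_of m) K" "S \<subseteq> K"
  shows "mtopology_of m closure_of S \<subseteq> K"
proof -
  interpret Metric_space "mspace m" "mdist m" by (rule Metric_space_mspace_mdist)
  have "closedin (mtopology_of m) K"
    using assms(1) compactin_imp_closedin Hausdorff_space_mtopology
    unfolding mtopology_of_def by blast
  then show ?thesis using assms(2) by (simp add: closure_of_minimal)
qed

text \<open>The two halves of the classical statement that an omega-limit set of a family whose
  tails approach a compact set \<open>K\<close> lies in \<open>K\<close> and attracts the family. The
  attraction also yields nonemptiness, since no nonempty set has finite semidistance
  to the empty set.\<close>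

lemma limit_set_subset_compact:
  fixes B :: "nat \<Rightarrow> 's set"
  assumes K: "compactin (mtopology_of m) K"
    and B: "\<And>s. B s \<subseteq> mspace m"
    and lim: "(\<lambda>s. semidist m (B s) K) \<longlonglongrightarrow> 0"
  shows "(\<Inter>s. mtopology_of m closure_of (\<Union>t\<in>{s..}. B t)) \<subseteq> K"
proof
  interpret Metric_space "mspace m" "mdist m" by (rule Metric_space_mspace_mdist)
  have KM: "K \<subseteq> mspace m" using K compactin_subset_topspace by fastforce
  fix v assume v: "v \<in> (\<Inter>s. mtopology_of m closure_of (\<Union>t\<in>{s..}. B t))"
  then have vM: "v \<in> mspace m" by (auto simp: in_closure_of_metric)
  have "\<exists>y\<in>K. y \<in> mspace m \<and> mdist m v y < r" if "r > 0" for r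
  proof -
    have "\<forall>\<^sub>F s in sequentially. \<forall>x\<in>B s. \<exists>y\<in>K. mdist m x y < r/2"
      by (rule semidist_tendsto_0D[OF lim]) (use that in simp)
    then obtain N where N: "\<And>s x. s \<ge> N \<Longrightarrow> x \<in> B s \<Longrightarrow> \<exists>y\<in>K. mdist m x y < r/2"
      by (auto simp: eventually_sequentially)
    have "v \<in> mtopology_of m closure_of (\<Union>t\<in>{N..}. B t)" using v by blast
    then obtain t x where x: "t \<ge> N" "x \<in> B t" "mdist m v x < r/2"
      using \<open>r > 0\<close> unfolding in_closure_of_metric by (meson UN_E atLeast_iff half_gt_zero)
    then obtain y where y: "y \<in> K" "mdist m x y < r/2" using N by blast
    have "mdist m v y \<le> mdist m v x + mdist m x y"
      using x y vM B KM by (intro triangle) auto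
    then show ?thesis using x y KM by (intro bexI[of _ y]) auto
  qed
  then have "v \<in> mtopology_of m closure_of K" using vM by (simp add: in_closure_of_metric)
  then show "v \<in> K" using compactin_closure_subset[OF K order_refl] by blast
qed

lemma limit_set_attracts:
  fixes B :: "nat \<Rightarrow> 's set"
  assumes K: "compactin (mtopology_of m) K"
    and B: "\<And>s. B s \<subseteq> mspace m"
    and lim: "(\<lambda>s. semidist m (B s) K) \<longlonglongrightarrow> 0"
  shows "(\<lambda>s. semidist m (B s) (\<Inter>s. mtopology_of m closure_of (\<Union>t\<in>{s..}. B t))) \<longlonglongrightarrow> 0"
    (is "(\<lambda>s. semidist m (B s) ?L) \<longlonglongrightarrow> 0")
proof (rule ccontr)
  interpret Metric_space "mspace m" "mdist m" by (rule Metric_space_mspace_mdist)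
  have KM: "K \<subseteq> mspace m" using K compactin_subset_topspace by fastforce
  define L where "L = ?L"
  assume "\<not> ?thesis"
  then obtain e where e: "e > 0"
    and "\<not> (\<forall>\<^sub>F s in sequentially. \<forall>x\<in>B s. \<exists>y\<in>L. mdist m x y < e)"
    unfolding L_def[symmetric] semidist_tendsto_0_iff by blast
  then have far: "\<exists>s\<ge>N. \<exists>x\<in>B s. \<forall>y\<in>L. \<not> mdist m x y < e" for N
    unfolding eventually_sequentially by blast
  \<comment> \<open>A sequence of points that stay away from the limit set but approach \<open>K\<close> must, by
    compactness, cluster at a point of \<open>K\<close>; that point lies in the limit set.\<close>
  have "\<exists>s x y. s \<ge> k \<and> x \<in> B s \<and> (\<forall>z\<in>L. \<not> mdist m x z < e) \<and> y \<in> K \<and>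
      mdist m x y < inverse (real (Suc k))" for k
  proof -
    have "\<forall>\<^sub>F s in sequentially. \<forall>x\<in>B s. \<exists>y\<in>K. mdist m x y < inverse (real (Suc k))"
      by (rule semidist_tendsto_0D[OF lim]) simp
    then obtain N where "\<forall>s\<ge>N. \<forall>x\<in>B s. \<exists>y\<in>K. mdist m x y < inverse (real (Suc k))"
      by (auto simp: eventually_sequentially)
    with far[of "max k N"] show ?thesis by (meson max.bounded_iff)
  qed
  then obtain s x y where s: "\<And>k. s k \<ge> k" and x: "\<And>k. x k \<in> B (s k)"
    and xL: "\<And>k z. z \<in> L \<Longrightarrow> \<not> mdist m (x k) z < e" and y: "\<And>k. y k \<in> K"
    and xy: "\<And>k. mdist m (x k) (y k) < inverse (real (Suc k))"
    by metis
  have "range y \<subseteq> K" using y by blast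
  moreover have "\<forall>\<sigma>::nat \<Rightarrow> 's. range \<sigma> \<subseteq> K \<longrightarrow>
      (\<exists>l r. l \<in> K \<and> strict_mono r \<and> limitin mtopology (\<sigma> \<circ> r) l sequentially)"
    using K[unfolded mtopology_of_def compactin_sequentially] by (rule conjunct2)
  ultimately obtain l r where l: "l \<in> K" and r: "strict_mono r"
    and yl: "limitin mtopology (y \<circ> r) l sequentially" by blast
  have near: "\<forall>\<^sub>F k in sequentially. mdist m (x (r k)) l < c" if "c > 0" for c
  proof -
    have 1: "\<forall>\<^sub>F k in sequentially. mdist m (y (r k)) l < c/2"
    proof -
      have "\<forall>\<^sub>F k in sequentially. (y \<circ> r) k \<in> mspace m \<and> mdist m ((y \<circ> r) k) l < c/2"
        using yl half_gt_zero[OF that] unfolding limitin_metric by blast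
      then show ?thesis by (rule eventually_mono) simp
    qed
    have "(\<lambda>k. inverse (real (Suc (r k)))) \<longlonglongrightarrow> 0"
      using LIMSEQ_subseq_LIMSEQ[OF LIMSEQ_inverse_real_of_nat r] by (simp add: o_def)
    then have 2: "\<forall>\<^sub>F k in sequentially. inverse (real (Suc (r k))) < c/2"
      by (rule order_tendstoD(2)) (use that in simp)
    from 1 2 show ?thesis
    proof eventually_elim
      case (elim k)
      have "mdist m (x (r k)) l \<le> mdist m (x (r k)) (y (r k)) + mdist m (y (r k)) l"
        using B x y KM l by (intro triangle) blast+
      with elim xy[of "r k"] show ?case by linarith
    qed
  qed
  have "l \<in> mtopology_of m closure_of (\<Union>t\<in>{s'..}. B t)" for s'
    unfolding in_closure_of_metric
  proof (intro conjI allI impI)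
    show "l \<in> mspace m" using l KM by blast
    fix c :: real assume "c > 0"
    from near[OF this] obtain N where N: "\<And>k. k \<ge> N \<Longrightarrow> mdist m (x (r k)) l < c"
      by (auto simp: eventually_sequentially)
    define k where "k = max N s'"
    have "s' \<le> s (r k)"
      using s[of "r k"] seq_suble[OF r, of k] by (simp add: k_def)
    show "\<exists>z\<in>\<Union>t\<in>{s'..}. B t. z \<in> mspace m \<and> mdist m l z < c"
    proof (intro bexI[of _ "x (r k)"] conjI)
      show "x (r k) \<in> mspace m" using x B by blast
      show "mdist m l (x (r k)) < c" using N[of k] by (simp add: commute k_def)
      show "x (r k) \<in> (\<Union>t\<in>{s'..}. B t)" using x[of "r k"] \<open>s' \<le> s (r k)\<close> by auto
    qed
  qed
  then have "l \<in> L" unfolding L_def by blast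
  from near[OF e] obtain k where "mdist m (x (r k)) l < e"
    by (auto simp: eventually_sequentially)
  then show False using xL[OF \<open>l \<in> L\<close>] by blast
qed

section \<open>Forward limit sets of nonautonomous difference equations\<close>

lemma general_solution_steps: "general_solution G (\<tau> + int s) \<tau> = iterate_steps G \<tau> s"
  by (simp add: general_solution_def fun_eq_iff)

lemma iterate_steps_add:
  "iterate_steps G \<tau> (r + s) u = iterate_steps G (\<tau> + int r) s (iterate_steps G \<tau> r u)"
  by (induction s) (simp_all add: algebra_simps)

lemma up_closed_add:
  fixes I :: "int set"
  assumes "\<forall>t\<in>I. {t..} \<subseteq> I" "t \<in> I"
  shows "t + int s \<in> I"
proof -
  have "t + int s \<in> {t..}" by simp
  then show ?thesis using assms by blast
qed

lemma filterlim_int_offset: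
  assumes "filterlim h at_top F"
  shows "filterlim (\<lambda>k. \<tau> + int (h k)) at_top F"
  unfolding filterlim_at_top
proof
  fix z
  have "\<forall>\<^sub>F k in F. nat (z - \<tau>) \<le> h k" using assms unfolding filterlim_at_top by blast
  then show "\<forall>\<^sub>F k in F. z \<le> \<tau> + int (h k)" by (rule eventually_mono) linarith
qed

lemma iterate_steps_invariant:
  assumes up: "\<forall>t\<in>I. {t..} \<subseteq> I"
    and inv: "\<forall>t\<in>I. G t ` V \<subseteq> V"
    and "\<tau> \<in> I" "u \<in> V"
  shows "iterate_steps G \<tau> s u \<in> V"
proof (induction s)
  case (Suc s)
  moreover have "\<tau> + int s \<in> I" by (rule up_closed_add[OF up \<open>\<tau> \<in> I\<close>])
  ultimately show ?case using inv by auto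
qed (use assms in simp)

text \<open>Strong asymptotic compactness concerns initial times that tend to infinity, whereas
  a forward limit set keeps the initial time fixed. Positive invariance bridges the gap: the
  first half of a long orbit stays in \<open>V\<close>, so the second half is an orbit segment that starts
  in \<open>V\<close> at a late time and is itself long.\<close>

lemma strongly_asymptotically_compact_attracts:
  assumes up: "\<forall>t\<in>I. {t..} \<subseteq> I"
    and inv: "\<forall>t\<in>I. G t ` V \<subseteq> V"
    and fib: "\<forall>t\<in>I. \<A> `` {t} = V"
    and sac: "strongly_asymptotically_compact m I U G \<A> K"
    and "\<tau> \<in> I"
  shows "(\<lambda>s. semidist m (iterate_steps G \<tau> s ` V) K) \<longlonglongrightarrow> 0"
proof -
  define h where "h k = k div 2" for k :: nat
  define s where "s k = Suc k - h k" for k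
  have hI: "\<tau> + int (h k) \<in> I" for k by (rule up_closed_add[OF up \<open>\<tau> \<in> I\<close>])
  have h: "filterlim h at_top sequentially"
    unfolding filterlim_at_top eventually_sequentially h_def
    by (metis div_le_mono nonzero_mult_div_cancel_left zero_neq_numeral)
  have s: "filterlim s at_top sequentially"
    by (rule filterlim_at_top_mono[OF h]) (auto simp: s_def h_def intro!: always_eventually)
  have t: "filterlim (\<lambda>k. \<tau> + int (h k)) at_top sequentially"
    using h by (rule filterlim_int_offset)
  have "(\<lambda>k. semidist m (general_solution G (\<tau> + int (h k) + int (s k)) (\<tau> + int (h k))
      ` (\<A> `` {\<tau> + int (h k)})) K) \<longlonglongrightarrow> 0"
  proof -
    have "1 \<le> s k" for k by (simp add: s_def h_def)
    with s t hI show ?thesis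
      using sac[unfolded strongly_asymptotically_compact_def, THEN conjunct2, THEN conjunct2,
          THEN conjunct2, THEN spec[of _ s], THEN spec[of _ "\<lambda>k. \<tau> + int (h k)"]]
      by blast
  qed
  then have lim: "(\<lambda>k. semidist m (iterate_steps G (\<tau> + int (h k)) (s k) ` V) K) \<longlonglongrightarrow> 0"
    by (simp add: general_solution_steps bspec[OF fib hI])
  have "iterate_steps G \<tau> (Suc k) ` V \<subseteq> iterate_steps G (\<tau> + int (h k)) (s k) ` V" for k
  proof -
    have "Suc k = h k + s k" by (simp add: s_def h_def)
    then have "iterate_steps G \<tau> (Suc k) u
        = iterate_steps G (\<tau> + int (h k)) (s k) (iterate_steps G \<tau> (h k) u)" for u
      by (simp only: iterate_steps_add)
    moreover have "iterate_steps G \<tau> (h k) u \<in> V" if "u \<in> V" for u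
      using iterate_steps_invariant[OF up inv \<open>\<tau> \<in> I\<close> that] .
    ultimately show ?thesis by auto
  qed
  then have "\<forall>\<^sub>F k in sequentially. semidist m (iterate_steps G \<tau> (Suc k) ` V) K
      \<le> semidist m (iterate_steps G (\<tau> + int (h k)) (s k) ` V) K"
    by (intro always_eventually allI semidist_mono_left)
  then have "(\<lambda>k. semidist m (iterate_steps G \<tau> (Suc k) ` V) K) \<longlonglongrightarrow> 0"
    by (intro tendsto_sandwich[OF _ _ tendsto_const lim]) auto
  then show ?thesis by (rule LIMSEQ_imp_Suc)
qed

lemma fibre_limit_set_eq:
  assumes "\<A> `` {\<tau>} = V"
  shows "fibre_limit_set m G \<A> \<tau>
    = (\<Inter>s. mtopology_of m closure_of (\<Union>t\<in>{s..}. iterate_steps G \<tau> t ` V))"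
  by (simp add: fibre_limit_set_def assms general_solution_steps)

lemma forward_limit_set_properties:
  assumes up: "\<forall>t\<in>I. {t..} \<subseteq> I" and "I \<noteq> {}"
    and inv: "\<forall>t\<in>I. G t ` V \<subseteq> V"
    and fib: "\<forall>t\<in>I. \<A> `` {t} = V"
    and V: "V \<noteq> {}" "V \<subseteq> mspace m"
    and sac: "strongly_asymptotically_compact m I U G \<A> K"
  shows "forward_limit_set m I G \<A> \<subseteq> K"
    and "forward_limit_set m I G \<A> \<noteq> {}"
    and "compactin (mtopology_of m) (forward_limit_set m I G \<A>)"
    and "forward_attracts m I G (forward_limit_set m I G \<A>) \<A>"
proof -
  let ?W = "forward_limit_set m I G \<A>"
  have K: "compactin (mtopology_of m) K"
    using sac by (simp add: strongly_asymptotically_compact_def)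
  have BM: "iterate_steps G \<tau> s ` V \<subseteq> mspace m" if "\<tau> \<in> I" for \<tau> s
    using iterate_steps_invariant[OF up inv that] V(2) by blast
  note lim = strongly_asymptotically_compact_attracts[OF up inv fib sac]
  have sub: "fibre_limit_set m G \<A> \<tau> \<subseteq> K" if "\<tau> \<in> I" for \<tau>
    unfolding fibre_limit_set_eq[OF bspec[OF fib that]]
    by (rule limit_set_subset_compact[OF K BM lim]) (use that in auto)
  have att: "(\<lambda>s. semidist m (iterate_steps G \<tau> s ` V) (fibre_limit_set m G \<A> \<tau>)) \<longlonglongrightarrow> 0"
    if "\<tau> \<in> I" for \<tau>
    unfolding fibre_limit_set_eq[OF bspec[OF fib that]]
    by (rule limit_set_attracts[OF K BM lim]) (use that in auto)
  show WK: "?W \<subseteq> K"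
    unfolding forward_limit_set_def
    by (rule compactin_closure_subset[OF K]) (use sub in blast)
  then show "compactin (mtopology_of m) ?W"
    by (rule closed_compactin[OF K]) (simp add: forward_limit_set_def)
  have incl: "fibre_limit_set m G \<A> \<tau> \<subseteq> ?W" if "\<tau> \<in> I" for \<tau>
  proof -
    have "K \<subseteq> topspace (mtopology_of m)" using K by (rule compactin_subset_topspace)
    then have "(\<Union>\<tau>\<in>I. fibre_limit_set m G \<A> \<tau>) \<subseteq> ?W"
      unfolding forward_limit_set_def using sub by (intro closure_of_subset) blast
    then show ?thesis using that by blast
  qed
  have attW: "(\<lambda>s. semidist m (iterate_steps G \<tau> s ` V) ?W) \<longlonglongrightarrow> 0" if "\<tau> \<in> I" for \<tau>
    unfolding semidist_tendsto_0_iff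
  proof (intro allI impI)
    fix e :: real assume "e > 0"
    then have "\<forall>\<^sub>F s in sequentially. \<forall>x\<in>iterate_steps G \<tau> s ` V.
        \<exists>y\<in>fibre_limit_set m G \<A> \<tau>. mdist m x y < e"
      by (rule semidist_tendsto_0D[OF att[OF that]])
    then show "\<forall>\<^sub>F s in sequentially. \<forall>x\<in>iterate_steps G \<tau> s ` V. \<exists>y\<in>?W. mdist m x y < e"
      by (rule eventually_mono) (use incl[OF that] in blast)
  qed
  then show "forward_attracts m I G ?W \<A>"
    by (simp add: forward_attracts_def general_solution_steps fib)
  obtain \<tau> where "\<tau> \<in> I" using \<open>I \<noteq> {}\<close> by blast
  from semidist_tendsto_0D[OF attW[OF this], of 1] have "\<forall>\<^sub>F s in sequentially.
      \<forall>x\<in>iterate_steps G \<tau> s ` V. \<exists>y\<in>?W. mdist m x y < 1"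
    by simp
  then show "?W \<noteq> {}" using V(1) by (auto simp: eventually_sequentially)
qed

section \<open>Perturbation of forward limit sets\<close>

lemma iterate_steps_bounded:
  fixes N :: "'s \<Rightarrow> real"
  assumes up: "\<forall>t\<in>I. {t..} \<subseteq> I"
    and inv: "\<forall>t\<in>I. G t ` U \<subseteq> U"
    and bdd: "\<And>r. \<exists>r'. \<forall>t\<in>I. \<forall>u\<in>U. N u \<le> r \<longrightarrow> N (G t u) \<le> r'"
  shows "\<exists>r'. \<forall>t\<in>I. \<forall>u\<in>U. N u \<le> r \<longrightarrow> N (iterate_steps G t s u) \<le> r'"
proof (induction s)
  case 0
  then show ?case by auto
next
  case (Suc s)
  then obtain r1 where r1: "\<forall>t\<in>I. \<forall>u\<in>U. N u \<le> r \<longrightarrow> N (iterate_steps G t s u) \<le> r1"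
    by blast
  obtain r2 where r2: "\<forall>t\<in>I. \<forall>u\<in>U. N u \<le> r1 \<longrightarrow> N (G t u) \<le> r2"
    using bdd by blast
  have "N (iterate_steps G t (Suc s) u) \<le> r2" if "t \<in> I" "u \<in> U" "N u \<le> r" for t u
  proof -
    have "t + int s \<in> I" by (rule up_closed_add[OF up that(1)])
    moreover have "iterate_steps G t s u \<in> U"
      by (rule iterate_steps_invariant[OF up inv that(1,2)])
    ultimately show ?thesis using r1 r2 that by simp
  qed
  then show ?case by blast
qed

text \<open>Error propagation over a fixed number of steps. The local error of one step and the
  initial error are amplified by a Lipschitz constant that depends only on the radii reached
  so far, so the total error is small uniformly in the initial time. The perturbed orbit
  stays in the invariant set \<open>V\<close>; the unperturbed one stays in some ball, where size is
  measured by an arbitrary function \<open>N\<close>.\<close>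

lemma iterate_steps_close:
  fixes N :: "'s \<Rightarrow> real" and G :: "nat \<Rightarrow> int \<Rightarrow> 's \<Rightarrow> 's"
  assumes up: "\<forall>t\<in>I. {t..} \<subseteq> I"
    and U: "U \<subseteq> mspace m" and invU: "\<And>n. \<forall>t\<in>I. G n t ` U \<subseteq> U"
    and V: "V \<subseteq> U" "\<And>u. u \<in> V \<Longrightarrow> N u \<le> c"
    and invV: "\<And>n. \<forall>t\<in>I. G n t ` V \<subseteq> V"
    and bdd: "\<And>r. \<exists>r'. \<forall>t\<in>I. \<forall>u\<in>U. N u \<le> r \<longrightarrow> N (G 0 t u) \<le> r'"
    and lip: "\<And>r. \<exists>l\<ge>0. \<forall>t\<in>I. \<forall>u\<in>U. \<forall>v\<in>U. N u \<le> r \<longrightarrow> N v \<le> r \<longrightarrow>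
      mdist m (G 0 t u) (G 0 t v) \<le> l * mdist m u v"
    and conv: "\<And>e. e > 0 \<Longrightarrow>
      \<forall>\<^sub>F n in sequentially. \<forall>t\<in>I. \<forall>u\<in>V. mdist m (G n t u) (G 0 t u) < e"
    and "e > 0"
  shows "\<exists>\<delta>>0. \<forall>\<^sub>F n in sequentially. \<forall>t\<in>I. \<forall>w\<in>V. \<forall>w'\<in>U. N w' \<le> r \<longrightarrow> mdist m w w' < \<delta> \<longrightarrow>
    mdist m (iterate_steps (G n) t s w) (iterate_steps (G 0) t s w') < e"
  using \<open>e > 0\<close>
proof (induction s arbitrary: e)
  case 0
  then show ?case by (auto intro!: exI[of _ e])
next
  case (Suc s)
  interpret Metric_space "mspace m" "mdist m" by (rule Metric_space_mspace_mdist)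
  obtain r1 where r1: "\<forall>t\<in>I. \<forall>u\<in>U. N u \<le> r \<longrightarrow> N (iterate_steps (G 0) t s u) \<le> r1"
    using iterate_steps_bounded[OF up invU bdd] by blast
  obtain l where l: "l \<ge> 0" and lip': "\<forall>t\<in>I. \<forall>u\<in>U. \<forall>v\<in>U. N u \<le> max c r1 \<longrightarrow> N v \<le> max c r1 \<longrightarrow>
      mdist m (G 0 t u) (G 0 t v) \<le> l * mdist m u v"
    using lip by blast
  \<comment> \<open>The inherited error may use up half of the tolerance after amplification by \<open>l\<close>; the
    summand \<open>1\<close> is there for the case \<open>l = 0\<close>.\<close>
  have pos: "e / (2 * (l + 1)) > 0" using Suc.prems l by simp
  from Suc.IH[OF pos] obtain \<delta> where \<delta>: "\<delta> > 0"
    and IH: "\<forall>\<^sub>F n in sequentially. \<forall>t\<in>I. \<forall>w\<in>V. \<forall>w'\<in>U. N w' \<le> r \<longrightarrow> mdist m w w' < \<delta> \<longrightarrow>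
      mdist m (iterate_steps (G n) t s w) (iterate_steps (G 0) t s w') < e / (2 * (l + 1))"
    by blast
  have "\<forall>\<^sub>F n in sequentially. \<forall>t\<in>I. \<forall>u\<in>V. mdist m (G n t u) (G 0 t u) < e / 2"
    by (rule conv) (use Suc.prems in simp)
  with IH have "\<forall>\<^sub>F n in sequentially. \<forall>t\<in>I. \<forall>w\<in>V. \<forall>w'\<in>U. N w' \<le> r \<longrightarrow> mdist m w w' < \<delta> \<longrightarrow>
    mdist m (iterate_steps (G n) t (Suc s) w) (iterate_steps (G 0) t (Suc s) w') < e"
  proof eventually_elim
    case (elim n)
    show ?case
    proof (intro ballI impI)
      fix t :: int and w w' assume *: "t \<in> I" "w \<in> V" "w' \<in> U" "N w' \<le> r" "mdist m w w' < \<delta>"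
      let ?x = "iterate_steps (G n) t s w" and ?y = "iterate_steps (G 0) t s w'"
      let ?t = "t + int s"
      have t: "?t \<in> I" by (rule up_closed_add[OF up *(1)])
      have x: "?x \<in> V" using iterate_steps_invariant[OF up invV] * by blast
      have y: "?y \<in> U" using iterate_steps_invariant[OF up invU] * by blast
      have "N ?x \<le> c" "N ?y \<le> r1" using V(2) x r1 * by blast+
      then have "mdist m (G 0 ?t ?x) (G 0 ?t ?y) \<le> l * mdist m ?x ?y"
        using lip' t x y V(1) by (auto simp: le_max_iff_disj)
      also have "\<dots> \<le> l * (e / (2 * (l + 1)))"
        using elim(1) * l by (intro mult_left_mono[OF less_imp_le]) auto
      also have "\<dots> \<le> e / 2" using l Suc.prems by (simp add: field_simps)
      finally have 1: "mdist m (G 0 ?t ?x) (G 0 ?t ?y) \<le> e / 2" .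
      have 2: "mdist m (G n ?t ?x) (G 0 ?t ?x) < e / 2" using elim(2) t x by blast
      have "mdist m (G n ?t ?x) (G 0 ?t ?y)
          \<le> mdist m (G n ?t ?x) (G 0 ?t ?x) + mdist m (G 0 ?t ?x) (G 0 ?t ?y)"
        using invU[of n] invU[of 0] t x y V(1) U by (intro triangle) blast+
      with 1 2 show "mdist m (iterate_steps (G n) t (Suc s) w)
          (iterate_steps (G 0) t (Suc s) w') < e" by simp
    qed
  qed
  then show ?case using \<delta> by blast
qed

text \<open>A point of a limit set of \<open>G n\<close> is approximated by late points of an orbit of \<open>G n\<close>.
  Stepping back a fixed time \<open>T\<close>, long enough for the unperturbed equation to bring all
  of \<open>K\<close> close to \<open>W\<close>, one meets an orbit point near \<open>K n\<close>. Replace that point by one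
  of \<open>K n\<close> and \<open>G n\<close> by \<open>G 0\<close> for the remaining \<open>T\<close> steps: for large \<open>n\<close>
  this changes little, and the new orbit ends near \<open>W\<close>. Since \<open>T\<close> does not depend
  on \<open>n\<close>, neither does the tolerance.\<close>

lemma forward_limit_set_perturbation:
  fixes G :: "nat \<Rightarrow> int \<Rightarrow> 's \<Rightarrow> 's"
  assumes up: "\<forall>t\<in>I. {t..} \<subseteq> I"
    and U: "U \<subseteq> mspace m" and invU: "\<And>n. \<forall>t\<in>I. G n t ` U \<subseteq> U"
    and VU: "V \<subseteq> U" and invV: "\<And>n. \<forall>t\<in>I. G n t ` V \<subseteq> V"
    and fib: "\<forall>t\<in>I. \<A> `` {t} = V"
    and sac: "\<And>n. strongly_asymptotically_compact m I U (G n) \<A> (K n)"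
    and W: "W \<subseteq> mspace m"
    and att: "(\<lambda>s. SUP \<tau>\<in>I. semidist m (iterate_steps (G 0) \<tau> s ` (\<Union>n. K n)) W) \<longlonglongrightarrow> 0"
    and close: "\<And>e T. e > 0 \<Longrightarrow> \<exists>\<delta>>0. \<forall>\<^sub>F n in sequentially. \<forall>t\<in>I. \<forall>w\<in>V. \<forall>w'\<in>(\<Union>n. K n).
      mdist m w w' < \<delta> \<longrightarrow>
      mdist m (iterate_steps (G n) t T w) (iterate_steps (G 0) t T w') < e"
  shows "(\<lambda>n. semidist m (forward_limit_set m I (G n) \<A>) W) \<longlonglongrightarrow> 0"
  unfolding semidist_tendsto_0_iff
proof (intro allI impI)
  interpret Metric_space "mspace m" "mdist m" by (rule Metric_space_mspace_mdist)
  fix e0 :: real assume "e0 > 0"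
  \<comment> \<open>Four errors add up: two approximations by points of the closures, the exchange of the
    orbits, and the distance to \<open>W\<close> after \<open>T\<close> steps.\<close>
  define e where "e = e0 / 4"
  have e: "e > 0" using \<open>e0 > 0\<close> by (simp add: e_def)
  have KU: "K n \<subseteq> U" for n using sac[of n] by (simp add: strongly_asymptotically_compact_def)
  have "(\<lambda>s. semidist m (\<Union>\<tau>\<in>I. iterate_steps (G 0) \<tau> s ` (\<Union>n. K n)) W) \<longlonglongrightarrow> 0"
    using att unfolding semidist_def SUP_UNION .
  then have "\<forall>\<^sub>F s in sequentially. \<forall>x\<in>(\<Union>\<tau>\<in>I. iterate_steps (G 0) \<tau> s ` (\<Union>n. K n)).
      \<exists>y\<in>W. mdist m x y < e"
    by (rule semidist_tendsto_0D) (rule e)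
  then obtain T where "\<forall>x\<in>(\<Union>\<tau>\<in>I. iterate_steps (G 0) \<tau> T ` (\<Union>n. K n)). \<exists>y\<in>W. mdist m x y < e"
    by (auto simp: eventually_sequentially)
  then have T: "\<exists>y\<in>W. mdist m (iterate_steps (G 0) t T w) y < e" if "t \<in> I" "w \<in> K n" for t w n
    using that by blast
  obtain \<delta> where \<delta>: "\<delta> > 0" and ev: "\<forall>\<^sub>F n in sequentially. \<forall>t\<in>I. \<forall>w\<in>V. \<forall>w'\<in>(\<Union>n. K n).
      mdist m w w' < \<delta> \<longrightarrow>
      mdist m (iterate_steps (G n) t T w) (iterate_steps (G 0) t T w') < e"
    using close[OF e] by blast
  from ev show "\<forall>\<^sub>F n in sequentially. \<forall>x\<in>forward_limit_set m I (G n) \<A>. \<exists>y\<in>W. mdist m x y < e0"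
  proof eventually_elim
    case (elim n)
    have late: "\<exists>y\<in>W. mdist m v y < 3 * e"
      if \<tau>: "\<tau> \<in> I" and v: "v \<in> fibre_limit_set m (G n) \<A> \<tau>" for \<tau> v
    proof -
      have "(\<lambda>s. semidist m (iterate_steps (G n) \<tau> s ` V) (K n)) \<longlonglongrightarrow> 0"
        by (rule strongly_asymptotically_compact_attracts[OF up invV fib sac \<tau>])
      then have "\<forall>\<^sub>F s in sequentially. \<forall>x\<in>iterate_steps (G n) \<tau> s ` V.
          \<exists>y\<in>K n. mdist m x y < \<delta>"
        by (rule semidist_tendsto_0D) (rule \<delta>)
      then obtain S where S: "\<And>s u. s \<ge> S \<Longrightarrow> u \<in> V \<Longrightarrow>
          \<exists>y\<in>K n. mdist m (iterate_steps (G n) \<tau> s u) y < \<delta>"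
        by (auto simp: eventually_sequentially)
      have "v \<in> mtopology_of m closure_of (\<Union>t\<in>{S + T..}. iterate_steps (G n) \<tau> t ` V)"
        using v unfolding fibre_limit_set_eq[OF bspec[OF fib \<tau>]] by blast
      then obtain t u where tu: "t \<ge> S + T" "u \<in> V" "mdist m v (iterate_steps (G n) \<tau> t u) < e"
        and vM: "v \<in> mspace m"
        using e unfolding in_closure_of_metric by (auto dest!: spec[of _ e])
      define s where "s = t - T"
      have ts: "t = s + T" "s \<ge> S" using tu by (auto simp: s_def)
      define w where "w = iterate_steps (G n) \<tau> s u"
      define z where "z = iterate_steps (G n) (\<tau> + int s) T w"
      have sI: "\<tau> + int s \<in> I" by (rule up_closed_add[OF up \<tau>])
      have wV: "w \<in> V"
        unfolding w_def using iterate_steps_invariant[OF up invV \<tau> tu(2)] .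
      have z: "iterate_steps (G n) \<tau> t u = z"
        by (simp add: ts iterate_steps_add z_def w_def)
      obtain w' where w': "w' \<in> K n" "mdist m w w' < \<delta>"
        using S[OF ts(2) tu(2)] unfolding w_def by blast
      define z' where "z' = iterate_steps (G 0) (\<tau> + int s) T w'"
      have zz': "mdist m z z' < e" unfolding z_def z'_def using elim sI wV w' by blast
      obtain y where y: "y \<in> W" "mdist m z' y < e" using T[OF sI w'(1)] unfolding z'_def by blast
      have zU: "z \<in> U" "z' \<in> U"
        unfolding z_def z'_def
        using iterate_steps_invariant[OF up invU sI]
          iterate_steps_invariant[OF up invU sI] wV VU w' KU by blast+
      then have M: "z \<in> mspace m" "z' \<in> mspace m" "y \<in> mspace m" using U y W by auto
      have "mdist m v y \<le> mdist m v z + (mdist m z z' + mdist m z' y)"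
        using triangle[of v z y] triangle[of z z' y] vM M by linarith
      also have "\<dots> < 3 * e" using tu(3) zz' y(2) z by simp
      finally show ?thesis using y(1) by blast
    qed
    show ?case
    proof
      fix x assume "x \<in> forward_limit_set m I (G n) \<A>"
      then obtain \<tau> v where v: "\<tau> \<in> I" "v \<in> fibre_limit_set m (G n) \<A> \<tau>" "v \<in> mspace m"
        "mdist m x v < e" and x: "x \<in> mspace m"
        using e unfolding forward_limit_set_def in_closure_of_metric by blast
      obtain y where y: "y \<in> W" "mdist m v y < 3 * e" using late[OF v(1,2)] by blast
      have "mdist m x y \<le> mdist m x v + mdist m v y"
        using x v y W by (intro triangle) auto
      then show "\<exists>y\<in>W. mdist m x y < e0" using y v e_def by (intro bexI[of _ y]) auto
    qed
  qed
qed

section \<open>The space of continuous functions\<close>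

lemma cont_spaceD:
  fixes u :: "'a::topological_space \<Rightarrow> 'b::metric_space"
  assumes "compact \<Omega>" "u \<in> mspace (cont_space \<Omega>)"
  shows "continuous_on \<Omega> u" "u \<in> extensional \<Omega>"
  using assms by (simp_all add: mspace_cont_space)

lemma norm_le_sup_norm:
  assumes "compact \<Omega>" "continuous_on \<Omega> u" "x \<in> \<Omega>"
  shows "norm (u x) \<le> sup_norm \<Omega> u"
proof -
  have "bounded (u ` \<Omega>)"
    using assms compact_continuous_image compact_imp_bounded by blast
  then have "bdd_above ((\<lambda>x. norm (u x)) ` \<Omega>)"
    unfolding bounded_iff bdd_above_def by auto
  then show ?thesis unfolding sup_norm_def using assms(3) by (rule cSUP_upper2) simp
qed

lemma sup_norm_le:
  assumes "\<Omega> \<noteq> {}" "\<And>x. x \<in> \<Omega> \<Longrightarrow> norm (u x) \<le> c"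
  shows "sup_norm \<Omega> u \<le> c"
  unfolding sup_norm_def using assms by (rule cSUP_least)

lemma sup_norm_nonneg:
  assumes "compact \<Omega>" "\<Omega> \<noteq> {}" "continuous_on \<Omega> u"
  shows "0 \<le> sup_norm \<Omega> u"
proof -
  obtain x where "x \<in> \<Omega>" using assms(2) by blast
  with norm_le_sup_norm[OF assms(1,3)] show ?thesis by (meson norm_ge_zero order_trans)
qed

section \<open>The integral operator\<close>

lemma continuous_integrable_lebesgue_on_compact:
  fixes h :: "real^'k \<Rightarrow> real^'d"
  assumes "compact \<Omega>" "continuous_on \<Omega> h"
  shows "integrable (lebesgue_on \<Omega>) h"
proof -
  have L: "\<Omega> \<in> lmeasurable" using assms(1) by (rule lmeasurable_compact)
  then interpret finite_measure "lebesgue_on \<Omega>" by (rule finite_measure_lebesgue_on)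
  obtain c where "\<forall>x\<in>\<Omega>. norm (h x) \<le> c"
    using compact_imp_bounded[OF compact_continuous_image[OF assms(2,1)]]
    unfolding bounded_iff by auto
  then show ?thesis
    using L assms(2) continuous_imp_measurable_on_sets_lebesgue
    by (intro integrable_const_bound[of _ c]) (auto simp: fmeasurableD)
qed

lemma continuous_on_kernel_section:
  assumes "continuous_on (\<Omega> \<times> \<Omega> \<times> Z) (\<lambda>(x, y, z). g x y z)"
    and "continuous_on \<Omega> u" "u ` \<Omega> \<subseteq> Z"
  shows "continuous_on (\<Omega> \<times> \<Omega>) (\<lambda>(x, y). g x y (u y))"
proof -
  have "continuous_on (\<Omega> \<times> \<Omega>) (\<lambda>q. (\<lambda>(x, y, z). g x y z) (fst q, snd q, u (snd q)))"
    using assms(3)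
    by (intro continuous_on_compose2[OF assms(1)] continuous_intros
        continuous_on_compose2[OF assms(2)]) auto
  then show ?thesis by (simp add: case_prod_unfold)
qed

lemma continuous_on_lebesgue_parameter:
  fixes h :: "real^'k \<Rightarrow> real^'k \<Rightarrow> real^'d"
  assumes \<Omega>: "compact \<Omega>" and h: "continuous_on (\<Omega> \<times> \<Omega>) (\<lambda>(x, y). h x y)"
  shows "continuous_on \<Omega> (\<lambda>x. LINT y|lebesgue_on \<Omega>. h x y)"
  unfolding continuous_on_iff
proof (intro ballI allI impI)
  have L: "\<Omega> \<in> lmeasurable" using \<Omega> by (rule lmeasurable_compact)
  then interpret finite_measure "lebesgue_on \<Omega>" by (rule finite_measure_lebesgue_on)
  have sec: "integrable (lebesgue_on \<Omega>) (h x)" if "x \<in> \<Omega>" for x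
  proof (rule continuous_integrable_lebesgue_on_compact[OF \<Omega>])
    have "continuous_on \<Omega> (\<lambda>y. (\<lambda>(x, y). h x y) (x, y))"
      using that by (intro continuous_on_compose2[OF h] continuous_intros) auto
    then show "continuous_on \<Omega> (h x)" by simp
  qed
  fix x and e :: real assume x: "x \<in> \<Omega>" and "e > 0"
  define M where "M = measure (lebesgue_on \<Omega>) (space (lebesgue_on \<Omega>))"
  define c where "c = e / (M + 1)"
  have M: "M \<ge> 0" by (simp add: M_def)
  then have "c > 0" using \<open>e > 0\<close> by (simp add: c_def)
  have "uniformly_continuous_on (\<Omega> \<times> \<Omega>) (\<lambda>(x, y). h x y)"
    using h \<Omega> by (intro compact_uniformly_continuous compact_Times)
  then obtain d where "d > 0" and d: "\<forall>q\<in>\<Omega> \<times> \<Omega>. \<forall>q'\<in>\<Omega> \<times> \<Omega>. dist q' q < d \<longrightarrow>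
      dist ((\<lambda>(x, y). h x y) q') ((\<lambda>(x, y). h x y) q) < c"
    using \<open>c > 0\<close> unfolding uniformly_continuous_on_def by blast
  have "dist (LINT y|lebesgue_on \<Omega>. h x' y) (LINT y|lebesgue_on \<Omega>. h x y) < e"
    if x': "x' \<in> \<Omega>" "dist x' x < d" for x'
  proof -
    have diff: "norm (h x' y - h x y) \<le> c" if "y \<in> \<Omega>" for y
      using d x x' that by (force simp: dist_Pair_Pair dist_norm)
    have "norm (LINT y|lebesgue_on \<Omega>. h x' y - h x y)
        \<le> (LINT y|lebesgue_on \<Omega>. norm (h x' y - h x y))"
      by (rule integral_norm_bound)
    also have "\<dots> \<le> (LINT y|lebesgue_on \<Omega>. c)"
      using sec[OF x] sec[OF x'(1)] diff by (intro integral_mono) auto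
    also have "\<dots> = c * M" by (simp add: M_def mult.commute)
    also have "\<dots> < e" using M \<open>e > 0\<close> by (simp add: c_def field_simps)
    finally show ?thesis
      using sec[OF x] sec[OF x'(1)] by (simp add: dist_norm)
  qed
  then show "\<exists>d>0. \<forall>x'\<in>\<Omega>. dist x' x < d \<longrightarrow>
      dist (LINT y|lebesgue_on \<Omega>. h x' y) (LINT y|lebesgue_on \<Omega>. h x y) < e"
    using \<open>d > 0\<close> by blast
qed

text \<open>This one estimate gives the growth bound and, with \<open>\<beta> = 0\<close>, the Lipschitz bound
  of the integral operator.\<close>

lemma norm_integral_le_affine_kernels:
  fixes h :: "real^'k \<Rightarrow> real^'d"
  assumes h: "integrable (lebesgue_on \<Omega>) h"
    and ker: "nonneg_kernel \<Omega> \<alpha>" "nonneg_kernel \<Omega> \<beta>"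
    and sup: "kernel_sup \<Omega> \<alpha> \<le> ennreal a" "kernel_sup \<Omega> \<beta> \<le> ennreal b"
    and nonneg: "0 \<le> a" "0 \<le> b" "0 \<le> c"
    and x: "x \<in> \<Omega>" and le: "\<And>y. y \<in> \<Omega> \<Longrightarrow> norm (h y) \<le> \<beta> x y + \<alpha> x y * c"
  shows "norm (LINT y|lebesgue_on \<Omega>. h y) \<le> b + a * c"
proof -
  let ?M = "lebesgue_on \<Omega>"
  have m: "\<alpha> x \<in> borel_measurable ?M" "\<beta> x \<in> borel_measurable ?M"
    and pos: "\<And>y. y \<in> \<Omega> \<Longrightarrow> 0 \<le> \<alpha> x y" "\<And>y. y \<in> \<Omega> \<Longrightarrow> 0 \<le> \<beta> x y"
    using ker x by (auto simp: nonneg_kernel_def)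
  have "ennreal (norm (LINT y|?M. h y)) \<le> (\<integral>\<^sup>+ y. ennreal (norm (h y)) \<partial>?M)"
    using h by (rule integral_norm_bound_ennreal)
  also have "\<dots> \<le> (\<integral>\<^sup>+ y. ennreal (\<beta> x y) + ennreal (\<alpha> x y) * ennreal c \<partial>?M)"
  proof (rule nn_integral_mono)
    fix y assume "y \<in> space ?M"
    then have y: "y \<in> \<Omega>" by simp
    show "ennreal (norm (h y)) \<le> ennreal (\<beta> x y) + ennreal (\<alpha> x y) * ennreal c"
      using le[OF y] pos[OF y] nonneg
      by (simp add: ennreal_leI ennreal_mult[symmetric] ennreal_plus[symmetric] del: ennreal_plus)
  qed
  also have "\<dots> = (\<integral>\<^sup>+ y. ennreal (\<beta> x y) \<partial>?M) + (\<integral>\<^sup>+ y. ennreal (\<alpha> x y) \<partial>?M) * ennreal c"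
    using m by (simp add: nn_integral_add nn_integral_multc)
  also have "\<dots> \<le> ennreal b + ennreal a * ennreal c"
  proof (intro add_mono mult_right_mono)
    show "(\<integral>\<^sup>+ y. ennreal (\<beta> x y) \<partial>?M) \<le> ennreal b"
      using SUP_upper[OF x] sup(2) unfolding kernel_sup_def by (rule order_trans)
    show "(\<integral>\<^sup>+ y. ennreal (\<alpha> x y) \<partial>?M) \<le> ennreal a"
      using SUP_upper[OF x] sup(1) unfolding kernel_sup_def by (rule order_trans)
  qed simp
  also have "\<dots> = ennreal (b + a * c)"
    using nonneg by (simp add: ennreal_mult)
  finally show ?thesis using nonneg by (simp add: ennreal_le_iff del: ennreal_plus)
qed

section \<open>Vector-valued projections\<close>

lemma vec_projection_closed:
  fixes u :: "real^'k \<Rightarrow> real^'d"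
  assumes \<Omega>: "compact \<Omega>"
    and X: "fin_dim_subspace \<Omega> Y" "bounded_projection \<Omega> Y (\<pi> n)" and "1 \<le> n"
    and u: "u \<in> mspace (cont_space \<Omega>)"
  shows "vec_projection \<Omega> \<pi> n u \<in> mspace (cont_space \<Omega>)"
proof -
  have comp: "(\<lambda>y\<in>\<Omega>. u y $ j) \<in> mspace (cont_space \<Omega>)" for j
    using cont_spaceD(1)[OF \<Omega> u]
    by (auto simp: mspace_cont_space[OF \<Omega>] cong: continuous_on_cong
        intro!: continuous_intros)
  have "\<pi> n ` mspace (cont_space \<Omega>) \<subseteq> mspace (cont_space \<Omega>)"
    using X by (simp add: bounded_projection_def fin_dim_subspace_def Let_def)
  then have "\<pi> n (\<lambda>y\<in>\<Omega>. u y $ j) \<in> mspace (cont_space \<Omega>)" for j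
    using comp by blast
  then have "continuous_on \<Omega> (\<pi> n (\<lambda>y\<in>\<Omega>. u y $ j))" for j
    by (simp add: mspace_cont_space[OF \<Omega>])
  then have "continuous_on \<Omega> (\<lambda>x. \<chi> j. \<pi> n (\<lambda>y\<in>\<Omega>. u y $ j) x)"
    by (intro continuous_on_vec_lambda)
  then show ?thesis
    using \<open>1 \<le> n\<close>
    by (simp add: vec_projection_def mspace_cont_space[OF \<Omega>] cong: continuous_on_cong)
qed

lemma vec_projection_scale:
  fixes u :: "real^'k \<Rightarrow> real^'d"
  assumes \<Omega>: "compact \<Omega>" and X: "bounded_projection \<Omega> Y (\<pi> n)" and "1 \<le> n"
    and u: "u \<in> mspace (cont_space \<Omega>)" and x: "x \<in> \<Omega>"
  shows "vec_projection \<Omega> \<pi> n (\<lambda>x\<in>\<Omega>. c *\<^sub>R u x) x = c *\<^sub>R vec_projection \<Omega> \<pi> n u x"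
proof -
  have comp: "(\<lambda>y\<in>\<Omega>. u y $ j) \<in> mspace (cont_space \<Omega>)" for j
    using cont_spaceD(1)[OF \<Omega> u]
    by (auto simp: mspace_cont_space[OF \<Omega>] cong: continuous_on_cong
        intro!: continuous_intros)
  have "\<pi> n (\<lambda>y\<in>\<Omega>. (\<lambda>x\<in>\<Omega>. c *\<^sub>R u x) y $ j) x = c * \<pi> n (\<lambda>y\<in>\<Omega>. u y $ j) x" for j
  proof -
    have "(\<lambda>y\<in>\<Omega>. (\<lambda>x\<in>\<Omega>. c *\<^sub>R u x) y $ j) = (\<lambda>y\<in>\<Omega>. c * (\<lambda>y\<in>\<Omega>. u y $ j) y)"
      by (rule ext) simp
    moreover have "\<pi> n (\<lambda>y\<in>\<Omega>. c * (\<lambda>y\<in>\<Omega>. u y $ j) y)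
        = (\<lambda>y\<in>\<Omega>. c * \<pi> n (\<lambda>y\<in>\<Omega>. u y $ j) y)"
      using X comp[of j] unfolding bounded_projection_def Let_def by blast
    ultimately show ?thesis using x by simp
  qed
  then show ?thesis
    using x \<open>1 \<le> n\<close> by (simp add: vec_projection_def vec_eq_iff)
qed

text \<open>The operator norm only speaks of the unit ball. Rescaling by \<open>sup_norm \<Omega> u + e\<close>
  rather than by \<open>sup_norm \<Omega> u\<close> avoids a separate treatment of \<open>u = 0\<close>.\<close>

lemma sup_norm_vec_projection_le:
  fixes u :: "real^'k \<Rightarrow> real^'d"
  assumes \<Omega>: "compact \<Omega>" "\<Omega> \<noteq> {}"
    and X: "fin_dim_subspace \<Omega> Y" "bounded_projection \<Omega> Y (\<pi> n)" and n: "1 \<le> n"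
    and p: "0 \<le> p" "op_norm \<Omega> (vec_projection \<Omega> \<pi> n
            :: (real^'k \<Rightarrow> real^'d) \<Rightarrow> (real^'k \<Rightarrow> real^'d)) \<le> ennreal p"
    and u: "u \<in> mspace (cont_space \<Omega>)"
  shows "sup_norm \<Omega> (vec_projection \<Omega> \<pi> n u) \<le> p * sup_norm \<Omega> u"
proof (rule sup_norm_le[OF \<Omega>(2)])
  fix x assume x: "x \<in> \<Omega>"
  note cu = cont_spaceD(1)[OF \<Omega>(1) u]
  have bound: "norm (vec_projection \<Omega> \<pi> n u x) \<le> p * c" if "c > sup_norm \<Omega> u" for c
  proof -
    have c: "c > 0" using that sup_norm_nonneg[OF \<Omega> cu] by linarith
    define v where "v = (\<lambda>x\<in>\<Omega>. inverse c *\<^sub>R u x)"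
    have v: "v \<in> mspace (cont_space \<Omega>)"
      unfolding v_def mspace_cont_space[OF \<Omega>(1)] using cu
      by (auto cong: continuous_on_cong intro!: continuous_intros)
    have "sup_norm \<Omega> v \<le> 1"
    proof (rule sup_norm_le[OF \<Omega>(2)])
      fix y assume "y \<in> \<Omega>"
      then show "norm (v y) \<le> 1"
        using norm_le_sup_norm[OF \<Omega>(1) cu, of y] that c by (simp add: v_def field_simps)
    qed
    then have "ennreal (sup_norm \<Omega> (vec_projection \<Omega> \<pi> n v)) \<le> ennreal p"
      using p(2) v unfolding op_norm_def SUP_le_iff by blast
    then have "sup_norm \<Omega> (vec_projection \<Omega> \<pi> n v) \<le> p"
      using p(1) by (simp add: ennreal_le_iff)
    then have "norm (vec_projection \<Omega> \<pi> n v x) \<le> p"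
      using norm_le_sup_norm[OF \<Omega>(1)
          cont_spaceD(1)[OF \<Omega>(1) vec_projection_closed[where \<pi> = \<pi> and n = n, OF \<Omega>(1) X n v]] x] by linarith
    then show ?thesis
      using c unfolding v_def vec_projection_scale[where \<pi> = \<pi> and n = n, OF \<Omega>(1) X(2) n u x]
      by (simp add: field_simps)
  qed
  have "(\<lambda>e. p * (sup_norm \<Omega> u + e)) \<midarrow>0\<rightarrow> p * (sup_norm \<Omega> u + 0)"
    by (intro tendsto_intros)
  then have "((\<lambda>e. p * (sup_norm \<Omega> u + e)) \<longlongrightarrow> p * sup_norm \<Omega> u) (at_right 0)"
    by (simp add: filterlim_at_split)
  then show "norm (vec_projection \<Omega> \<pi> n u x) \<le> p * sup_norm \<Omega> u"
    by (rule tendsto_lowerbound)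
      (auto simp: eventually_at_right_less intro!: bound eventually_at_rightI[of 0 1])
qed

section \<open>The absorbing radius\<close>

lemma atLeastAtMost_int_Suc: "{\<tau>..\<tau> + int s} = insert (\<tau> + int s) {\<tau>..\<tau> + int s - 1}"
  by auto

text \<open>The comparison principle for the scalar affine recursion
  \<open>r (t + 1) = p * b t + p * a t * r t\<close>, whose solution is the right-hand side.\<close>

lemma affine_recursion_bound:
  fixes a b :: "int \<Rightarrow> real" and x :: "nat \<Rightarrow> real"
  assumes a: "\<And>t. t \<ge> \<tau> \<Longrightarrow> 0 \<le> a t" and p: "0 \<le> p"
    and step: "\<And>s. x (Suc s) \<le> p * b (\<tau> + int s) + p * a (\<tau> + int s) * x s"
  shows "x s \<le> x 0 * (\<Prod>l\<in>{\<tau>..\<tau> + int s - 1}. p * a l)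
    + p * (\<Sum>l1\<in>{\<tau>..\<tau> + int s - 1}. b l1 * (\<Prod>l2\<in>{l1 + 1..\<tau> + int s - 1}. p * a l2))"
proof (induction s)
  case (Suc s)
  let ?t = "\<tau> + int s"
  let ?P = "\<Prod>l\<in>{\<tau>..?t - 1}. p * a l"
  let ?S = "\<Sum>l1\<in>{\<tau>..?t - 1}. b l1 * (\<Prod>l2\<in>{l1 + 1..?t - 1}. p * a l2)"
  have P: "(\<Prod>l\<in>{\<tau>..?t}. p * a l) = p * a ?t * ?P"
    unfolding atLeastAtMost_int_Suc by simp
  have "(\<Prod>l2\<in>{l1 + 1..?t}. p * a l2) = p * a ?t * (\<Prod>l2\<in>{l1 + 1..?t - 1}. p * a l2)"
    if "l1 \<in> {\<tau>..?t - 1}" for l1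
  proof -
    have "{l1 + 1..?t} = insert ?t {l1 + 1..?t - 1}" using that by auto
    then show ?thesis by simp
  qed
  then have "(\<Sum>l1\<in>{\<tau>..?t - 1}. b l1 * (\<Prod>l2\<in>{l1 + 1..?t}. p * a l2)) = p * a ?t * ?S"
    unfolding sum_distrib_left by (intro sum.cong) (simp_all add: mult_ac)
  then have S: "(\<Sum>l1\<in>{\<tau>..?t}. b l1 * (\<Prod>l2\<in>{l1 + 1..?t}. p * a l2)) = b ?t + p * a ?t * ?S"
    unfolding atLeastAtMost_int_Suc[of \<tau> s] by simp
  have "x (Suc s) \<le> p * b ?t + p * a ?t * x s" by (rule step)
  also have "\<dots> \<le> p * b ?t + p * a ?t * (x 0 * ?P + p * ?S)"
    using Suc.IH a[of ?t] p by (intro add_left_mono mult_left_mono) auto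
  also have "\<dots> = x 0 * (p * a ?t * ?P) + p * (b ?t + p * a ?t * ?S)"
    by (simp add: algebra_simps)
  finally show ?case using P S by (simp add: algebra_simps)
qed simp

text \<open>Passing from \<open>\<tau>\<close> to \<open>\<tau> + 1\<close> drops one summand, which is a multiple of a
  vanishing product.\<close>

lemma limit_radius_step:
  fixes a b :: "int \<Rightarrow> real"
  assumes P: "(\<lambda>s::nat. \<Prod>l\<in>{\<tau> + 1..\<tau> + 1 + int s - 1}. p * a l) \<longlonglongrightarrow> 0"
    and R: "((\<lambda>t::int. p * (\<Sum>l1\<in>{\<tau>..t - 1}. b l1 * (\<Prod>l2\<in>{l1 + 1..t - 1}. p * a l2)))
      \<longlongrightarrow> R) at_top"
    and R': "((\<lambda>t::int. p * (\<Sum>l1\<in>{\<tau> + 1..t - 1}. b l1 * (\<Prod>l2\<in>{l1 + 1..t - 1}. p * a l2)))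
      \<longlongrightarrow> R') at_top"
  shows "R = R'"
proof -
  define S where "S = (\<lambda>\<tau> t::int. p * (\<Sum>l1\<in>{\<tau>..t - 1}. b l1 * (\<Prod>l2\<in>{l1 + 1..t - 1}. p * a l2)))"
  let ?t = "\<lambda>s. \<tau> + 1 + int s"
  have t: "filterlim ?t at_top sequentially"
    by (intro filterlim_int_offset filterlim_ident)
  have "S \<tau> (?t s) = p * b \<tau> * (\<Prod>l\<in>{\<tau> + 1..?t s - 1}. p * a l) + S (\<tau> + 1) (?t s)" for s
  proof -
    have "{\<tau>..?t s - 1} = insert \<tau> {\<tau> + 1..?t s - 1}" by auto
    then show ?thesis by (simp add: S_def algebra_simps)
  qed
  moreover have "(\<lambda>s. p * b \<tau> * (\<Prod>l\<in>{\<tau> + 1..?t s - 1}. p * a l) + S (\<tau> + 1) (?t s))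
      \<longlonglongrightarrow> p * b \<tau> * 0 + R'"
    unfolding S_def by (intro tendsto_intros P filterlim_compose[OF R' t])
  ultimately have "(\<lambda>s. S \<tau> (?t s)) \<longlonglongrightarrow> R'" by simp
  moreover have "(\<lambda>s. S \<tau> (?t s)) \<longlonglongrightarrow> R"
    unfolding S_def by (rule filterlim_compose[OF R t])
  ultimately show ?thesis by (rule LIMSEQ_unique[symmetric])
qed

lemma discrete_interval_up_closed:
  assumes "discrete_interval I" "\<not> bdd_above I"
  shows "\<forall>t\<in>I. {t..} \<subseteq> I"
proof (intro ballI subsetI)
  fix t t' assume t: "t \<in> I" "t' \<in> {t..}"
  obtain J :: "real set" where J: "is_interval J" "I = {t. real_of_int t \<in> J}"
    using assms(1) by (auto simp: discrete_interval_def)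
  obtain s where s: "s \<in> I" "t' < s"
    using assms(2) unfolding bdd_above_def by (auto simp: not_le)
  have "real_of_int t' \<in> J"
    using J t s by (auto intro: mem_is_interval_1_I[of J "real_of_int t" "real_of_int s"])
  then show "t' \<in> I" using J by simp
qed

lemma up_closed_constant:
  fixes R :: "int \<Rightarrow> real"
  assumes up: "\<forall>t\<in>I. {t..} \<subseteq> I" and step: "\<And>t. t \<in> I \<Longrightarrow> R t = R (t + 1)"
    and "t \<in> I" "t' \<in> I"
  shows "R t = R t'"
proof -
  have add: "R t = R (t + int s)" if "t \<in> I" for t s
  proof (induction s)
    case (Suc s)
    then show ?case using step[OF up_closed_add[OF up that], of s] by (simp add: algebra_simps)
  qed simp
  show ?thesis
  proof (cases "t \<le> t'")
    case True
    then show ?thesis using add[OF \<open>t \<in> I\<close>, of "nat (t' - t)"] by simp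
  next
    case False
    then show ?thesis using add[OF \<open>t' \<in> I\<close>, of "nat (t - t')"] by simp
  qed
qed

section \<open>Forward limit sets of collocation discretizations\<close>

theorem theorem3p10:
  fixes I :: "int set"
    and \<Omega> :: "(real^'k::finite) set"
    and Z :: "(real^'d::finite) set"
    and f :: "int \<Rightarrow> real^'k \<Rightarrow> real^'k \<Rightarrow> real^'d \<Rightarrow> real^'d"
    and \<alpha> \<beta> :: "int \<Rightarrow> real^'k \<Rightarrow> real^'k \<Rightarrow> real"
    and a b :: "int \<Rightarrow> real"
    and X :: "nat \<Rightarrow> (real^'k \<Rightarrow> real) set"
    and \<pi> :: "nat \<Rightarrow> (real^'k \<Rightarrow> real) \<Rightarrow> (real^'k \<Rightarrow> real)"
    and p \<rho> :: real
    and R :: "int \<Rightarrow> real"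
    and U :: "(real^'k \<Rightarrow> real^'d) set"
    and F :: "nat \<Rightarrow> int \<Rightarrow> (real^'k \<Rightarrow> real^'d) \<Rightarrow> (real^'k \<Rightarrow> real^'d)"
    and \<phi> :: "nat \<Rightarrow> int \<Rightarrow> int \<Rightarrow> (real^'k \<Rightarrow> real^'d) \<Rightarrow> (real^'k \<Rightarrow> real^'d)"
    and \<A> :: "(int \<times> (real^'k \<Rightarrow> real^'d)) set"
    and K :: "nat \<Rightarrow> (real^'k \<Rightarrow> real^'d) set"
    and \<omega> :: "nat \<Rightarrow> (real^'k \<Rightarrow> real^'d) set"
  assumes I: "discrete_interval I" "\<not> bdd_above I"
    and \<Omega>: "compact \<Omega>" "\<Omega> \<noteq> {}"
    and Z: "closed Z" "Z \<noteq> {}"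
    and U_def: "U = state_set \<Omega> Z"
    and f_cont: "\<And>t. t \<in> I \<Longrightarrow> continuous_on (\<Omega> \<times> \<Omega> \<times> Z) (\<lambda>(x, y, z). f t x y z)"
    and kernels: "\<And>t. t \<in> I \<Longrightarrow> nonneg_kernel \<Omega> (\<alpha> t)" "\<And>t. t \<in> I \<Longrightarrow> nonneg_kernel \<Omega> (\<beta> t)"
    and a: "\<And>t. t \<in> I \<Longrightarrow> 0 \<le> a t \<and> kernel_sup \<Omega> (\<alpha> t) = ennreal (a t)"
    and b: "\<And>t. t \<in> I \<Longrightarrow> 0 \<le> b t \<and> kernel_sup \<Omega> (\<beta> t) = ennreal (b t)"
    and growth: "\<And>t x y z. t \<in> I \<Longrightarrow> x \<in> \<Omega> \<Longrightarrow> y \<in> \<Omega> \<Longrightarrow> z \<in> Z \<Longrightarrow>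
                   norm (f t x y z) \<le> \<beta> t x y + \<alpha> t x y * norm z"
    and invariance: "\<And>t x u. t \<in> I \<Longrightarrow> x \<in> \<Omega> \<Longrightarrow> u \<in> U \<Longrightarrow>
                   (LINT y|lebesgue_on \<Omega>. f t x y (u y)) \<in> Z"
    and projections: "\<And>n. 1 \<le> n \<Longrightarrow> fin_dim_subspace \<Omega> (X n)"
                   "\<And>n. 1 \<le> n \<Longrightarrow> bounded_projection \<Omega> (X n) (\<pi> n)"
    and stability: "1 \<le> p"
       "(SUP n\<in>{1..}. op_norm \<Omega> (vec_projection \<Omega> \<pi> n
            :: (real^'k \<Rightarrow> real^'d) \<Rightarrow> (real^'k \<Rightarrow> real^'d))) = ennreal p"
    and proj_U: "\<And>n. 1 \<le> n \<Longrightarrow> vec_projection \<Omega> \<pi> n ` U \<subseteq> U"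
    and F_def: "F = collocation_op \<Omega> f \<pi>"
    and \<phi>_def: "\<phi> = (\<lambda>n. general_solution (F n))"
    and \<rho>: "1 < \<rho>"
    and prod_lim: "\<And>\<tau>. \<tau> \<in> I \<Longrightarrow> (\<lambda>s::nat. \<Prod>l\<in>{\<tau>..\<tau> + int s - 1}. p * a l) \<longlonglongrightarrow> 0"
    and R_lim: "\<And>\<tau>. \<tau> \<in> I \<Longrightarrow>
       ((\<lambda>t::int. p * (\<Sum>l1\<in>{\<tau>..t - 1}. b l1 * (\<Prod>l2\<in>{l1 + 1..t - 1}. p * a l2))) \<longlongrightarrow> R \<tau>) at_top"
    and R_pos: "\<And>\<tau>. \<tau> \<in> I \<Longrightarrow> 0 < R \<tau>"
    and absorbing: "\<And>\<tau>. \<tau> \<in> I \<Longrightarrow> p * b \<tau> \<le> \<rho> * R \<tau> * (1 - p * a \<tau>)"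
    and \<A>_def: "\<A> = {(\<tau>, u). \<tau> \<in> I \<and> u \<in> U \<and> sup_norm \<Omega> u \<le> \<rho> * R \<tau>}"
    and \<omega>_def: "\<omega> = (\<lambda>n. forward_limit_set (cont_space \<Omega>) I (F n) \<A>)"
    and asym_compact: "\<And>n. strongly_asymptotically_compact (cont_space \<Omega>) I U (F n) \<A> (K n)"
  shows "(\<forall>\<tau>\<in>I. \<forall>\<tau>'\<in>I. R \<tau> = R \<tau>') \<and>
    (\<forall>n. \<omega> n \<subseteq> K n \<and> \<omega> n \<noteq> {} \<and> compactin (mtopology_of (cont_space \<Omega>)) (\<omega> n) \<and>
         forward_attracts (cont_space \<Omega>) I (F n) (\<omega> n) \<A>) \<and>
    (norm_bounded \<Omega> (\<Union>n. K n) \<and>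
     (\<forall>r>0. \<exists>r'>0. \<forall>t\<in>I. \<forall>u\<in>U. sup_norm \<Omega> u \<le> r \<longrightarrow> sup_norm \<Omega> (F 0 t u) \<le> r') \<and>
     (\<lambda>s::nat. SUP \<tau>\<in>I. semidist (cont_space \<Omega>) (\<phi> 0 (\<tau> + int s) \<tau> ` (\<Union>n. K n)) (\<omega> 0))
        \<longlonglongrightarrow> 0 \<and>
     (\<forall>s::nat \<Rightarrow> nat. \<forall>\<tau>::nat \<Rightarrow> int.
        (\<forall>k. 1 \<le> s k \<and> \<tau> k \<in> I) \<and> filterlim \<tau> at_top sequentially \<longrightarrow>
        (\<forall>n. (\<lambda>k. semidist (cont_space \<Omega>) (\<phi> n (\<tau> k + int (s k)) (\<tau> k) ` K n) (K n))
               \<longlonglongrightarrow> 0)) \<and>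
     (\<exists>L::int \<Rightarrow> real \<Rightarrow> real^'k \<Rightarrow> real^'k \<Rightarrow> real.
        (\<forall>t\<in>I. \<forall>r>0. nonneg_kernel \<Omega> (L t r) \<and>
           (\<forall>x\<in>\<Omega>. \<forall>y\<in>\<Omega>. \<forall>z\<in>Z \<inter> cball 0 r. \<forall>z'\<in>Z \<inter> cball 0 r.
              norm (f t x y z - f t x y z') \<le> L t r x y * norm (z - z'))) \<and>
        (\<forall>r>0. (SUP t\<in>I. kernel_sup \<Omega> (L t r)) < \<infinity>)) \<and>
     convergent_discretization \<Omega> I U F
     \<longrightarrow> (\<lambda>n. semidist (cont_space \<Omega>) (\<omega> n) (\<omega> 0)) \<longlonglongrightarrow> 0)"
proof -
  let ?M = "cont_space \<Omega> :: (real^'k \<Rightarrow> real^'d) metric"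
  have up: "\<forall>t\<in>I. {t..} \<subseteq> I" using I by (rule discrete_interval_up_closed)
  have "I \<noteq> {}" using I(2) by auto
  then obtain \<tau>0 where \<tau>0: "\<tau>0 \<in> I" by blast
  have U: "U = {u \<in> mspace ?M. \<forall>x\<in>\<Omega>. u x \<in> Z}" by (simp add: U_def state_set_def)
  then have UM: "U \<subseteq> mspace ?M" by blast
  note cU = cont_spaceD(1)[OF \<Omega>(1) subsetD[OF UM]]

  \<comment> \<open>The projections cost a factor \<open>p\<close>; as \<open>1 \<le> p\<close>, the resulting bound holds for
    all \<open>n\<close>, including the unprojected equation.\<close>
  have F0: "F 0 t u = integral_op \<Omega> (f t) u" for t u
    by (simp add: F_def collocation_op_def vec_projection_def)
  have Fn: "F n t u = vec_projection \<Omega> \<pi> n (F 0 t u)" for n t u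
    by (simp add: F_def collocation_op_def vec_projection_def)
  have h_cont: "continuous_on (\<Omega> \<times> \<Omega>) (\<lambda>(x, y). f t x y (u y))" if "t \<in> I" "u \<in> U" for t u
    using that U by (intro continuous_on_kernel_section[OF f_cont cU]) auto
  have h_int: "integrable (lebesgue_on \<Omega>) (\<lambda>y. f t x y (u y))" if "t \<in> I" "u \<in> U" "x \<in> \<Omega>" for t u x
  proof (rule continuous_integrable_lebesgue_on_compact[OF \<Omega>(1)])
    have "continuous_on \<Omega> (\<lambda>y. (\<lambda>(x, y). f t x y (u y)) (x, y))"
      using that(3)
      by (intro continuous_on_compose2[OF h_cont[OF that(1,2)]] continuous_intros) auto
    then show "continuous_on \<Omega> (\<lambda>y. f t x y (u y))" by simp
  qed
  have F0U: "F 0 t u \<in> U" if "t \<in> I" "u \<in> U" for t u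
    using continuous_on_lebesgue_parameter[OF \<Omega>(1) h_cont[OF that]] invariance[OF that(1) _ that(2)]
    by (auto simp: U F0 integral_op_def mspace_cont_space[OF \<Omega>(1)] cong: continuous_on_cong)
  have FU: "\<forall>t\<in>I. F n t ` U \<subseteq> U" for n
  proof (cases "n = 0")
    case True
    then show ?thesis using F0U by blast
  next
    case False
    then show ?thesis using F0U proj_U[of n] by (auto simp: Fn[of n])
  qed
  have F0_norm: "sup_norm \<Omega> (F 0 t u) \<le> b t + a t * sup_norm \<Omega> u" if t: "t \<in> I" and u: "u \<in> U" for t u
  proof (rule sup_norm_le[OF \<Omega>(2)])
    fix x assume x: "x \<in> \<Omega>"
    have "norm (f t x y (u y)) \<le> \<beta> t x y + \<alpha> t x y * sup_norm \<Omega> u" if y: "y \<in> \<Omega>" for y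
    proof -
      have "norm (f t x y (u y)) \<le> \<beta> t x y + \<alpha> t x y * norm (u y)"
        using growth[OF t x y] u y U by auto
      also have "\<alpha> t x y * norm (u y) \<le> \<alpha> t x y * sup_norm \<Omega> u"
        using kernels(1)[OF t] x y norm_le_sup_norm[OF \<Omega>(1) cU[OF u] y]
        by (intro mult_left_mono) (auto simp: nonneg_kernel_def)
      finally show ?thesis by simp
    qed
    then have "norm (LINT y|lebesgue_on \<Omega>. f t x y (u y)) \<le> b t + a t * sup_norm \<Omega> u"
      using a[OF t] b[OF t] sup_norm_nonneg[OF \<Omega> cU[OF u]]
      by (intro norm_integral_le_affine_kernels[OF h_int[OF t u x] kernels(1)[OF t] kernels(2)[OF t]
            _ _ _ _ _ x]) auto
    then show "norm (F 0 t u x) \<le> b t + a t * sup_norm \<Omega> u"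
      using x by (simp add: F0 integral_op_def)
  qed
  have Fn_norm: "sup_norm \<Omega> (F n t u) \<le> p * b t + p * a t * sup_norm \<Omega> u" if t: "t \<in> I" and u: "u \<in> U" for n t u
  proof -
    note F0' = F0U[OF t u]
    have "sup_norm \<Omega> (F n t u) \<le> p * sup_norm \<Omega> (F 0 t u)"
    proof (cases "n = 0")
      case True
      then show ?thesis
        using stability(1) mult_right_mono[OF stability(1) sup_norm_nonneg[OF \<Omega> cU[OF F0']]] by simp
    next
      case False
      then have n: "1 \<le> n" by simp
      have "op_norm \<Omega> (vec_projection \<Omega> \<pi> n :: (real^'k \<Rightarrow> real^'d) \<Rightarrow> (real^'k \<Rightarrow> real^'d))
          \<le> ennreal p"
        unfolding stability(2)[symmetric] by (rule SUP_upper) (use n in simp)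
      then show ?thesis
        unfolding Fn[of n]
        using stability(1) F0' UM
        by (intro sup_norm_vec_projection_le[where \<pi> = \<pi> and n = n,
              OF \<Omega> projections(1)[OF n] projections(2)[OF n] n]) auto
    qed
    also have "\<dots> \<le> p * (b t + a t * sup_norm \<Omega> u)"
      using F0_norm[OF t u] stability(1) by (intro mult_left_mono) auto
    finally show ?thesis by (simp add: algebra_simps)
  qed

  \<comment> \<open>The fibres of \<open>\<A>\<close> are one fixed nonempty set that every equation leaves invariant.\<close>
  have R_step: "R t = R (t + 1)" if "t \<in> I" for t
  proof -
    have "t + 1 \<in> I" using up_closed_add[OF up that, of 1] by simp
    then show ?thesis
      using limit_radius_step[OF prod_lim R_lim[OF that] R_lim] by blast
  qed
  have R_const: "R t = R t'" if "t \<in> I" "t' \<in> I" for t t'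
    using up_closed_constant[where R = R, OF up R_step that] .
  define V where "V = {u \<in> U. sup_norm \<Omega> u \<le> \<rho> * R \<tau>0}"
  have VU: "V \<subseteq> U" by (auto simp: V_def)
  have fib: "\<forall>t\<in>I. \<A> `` {t} = V"
    using R_const[OF \<tau>0] by (auto simp: \<A>_def V_def)
  have FV: "\<forall>t\<in>I. F n t ` V \<subseteq> V" for n
  proof (intro ballI image_subsetI)
    fix t u assume t: "t \<in> I" and u: "u \<in> V"
    have uU: "u \<in> U" and ur: "sup_norm \<Omega> u \<le> \<rho> * R t"
      using u R_const[OF t \<tau>0] by (auto simp: V_def)
    have "sup_norm \<Omega> (F n t u) \<le> p * b t + p * a t * sup_norm \<Omega> u" by (rule Fn_norm[OF t uU])
    also have "\<dots> \<le> \<rho> * R t * (1 - p * a t) + p * a t * (\<rho> * R t)"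
      using absorbing[OF t] a[OF t] stability(1) ur by (intro add_mono mult_left_mono) auto
    also have "\<dots> = \<rho> * R \<tau>0" using R_const[OF t \<tau>0] by (simp add: algebra_simps)
    finally show "F n t u \<in> V" using FU[of n] t uU by (auto simp: V_def)
  qed
  \<comment> \<open>The norms along any orbit are asymptotically at most \<open>R \<tau>0\<close>, which is strictly
    less than the radius of \<open>V\<close>, so the orbit of a constant function with value in \<open>Z\<close> reaches \<open>V\<close>.\<close>
  have "V \<noteq> {}"
  proof -
    obtain z where z: "z \<in> Z" using Z(2) by blast
    define u where "u = (\<lambda>x\<in>\<Omega>. z)"
    have u: "u \<in> U"
      using z by (auto simp: u_def U mspace_cont_space[OF \<Omega>(1)] cong: continuous_on_cong)
    let ?x = "\<lambda>s. sup_norm \<Omega> (iterate_steps (F 0) \<tau>0 s u)"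
    let ?P = "\<lambda>s. \<Prod>l\<in>{\<tau>0..\<tau>0 + int s - 1}. p * a l"
    let ?S = "\<lambda>t. p * (\<Sum>l1\<in>{\<tau>0..t - 1}. b l1 * (\<Prod>l2\<in>{l1 + 1..t - 1}. p * a l2))"
    have it: "iterate_steps (F 0) \<tau>0 s u \<in> U" for s
      by (rule iterate_steps_invariant[OF up FU \<tau>0 u])
    have le: "?x s \<le> ?x 0 * ?P s + ?S (\<tau>0 + int s)" for s
    proof (rule affine_recursion_bound)
      show "0 \<le> a t" if "t \<ge> \<tau>0" for t using a up \<tau>0 that by blast
      show "?x (Suc s) \<le> p * b (\<tau>0 + int s) + p * a (\<tau>0 + int s) * ?x s" for s
        using Fn_norm[OF up_closed_add[OF up \<tau>0] it, of 0] by simp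
    qed (use stability(1) in simp)
    have lim: "(\<lambda>s. ?x 0 * ?P s + ?S (\<tau>0 + int s)) \<longlonglongrightarrow> ?x 0 * 0 + R \<tau>0"
      by (intro tendsto_intros prod_lim[OF \<tau>0] filterlim_compose[OF R_lim[OF \<tau>0]]
          filterlim_int_offset filterlim_ident)
    have "?x 0 * 0 + R \<tau>0 < \<rho> * R \<tau>0" using R_pos[OF \<tau>0] \<rho> by simp
    from order_tendstoD(2)[OF lim this]
    obtain s where "?x 0 * ?P s + ?S (\<tau>0 + int s) < \<rho> * R \<tau>0"
      unfolding eventually_sequentially by blast
    with le[of s] have "?x s < \<rho> * R \<tau>0" by linarith
    then have "iterate_steps (F 0) \<tau>0 s u \<in> V" using it by (simp add: V_def)
    then show ?thesis by blast
  qed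
  have VM: "V \<subseteq> mspace ?M" using VU UM by blast
  note props = forward_limit_set_properties[OF up \<open>I \<noteq> {}\<close> FV fib \<open>V \<noteq> {}\<close> VM asym_compact]

  \<comment> \<open>In the notation of \<open>iterate_steps_close\<close>, size is measured by \<open>sup_norm \<Omega>\<close>. The
    assumptions speak of positive radii only, hence the maxima with \<open>1\<close>.\<close>
  have main: "(\<lambda>n. semidist ?M (\<omega> n) (\<omega> 0)) \<longlonglongrightarrow> 0"
    if K: "norm_bounded \<Omega> (\<Union>n. K n)"
      and F_bdd: "\<forall>r>0. \<exists>r'>0. \<forall>t\<in>I. \<forall>u\<in>U. sup_norm \<Omega> u \<le> r \<longrightarrow> sup_norm \<Omega> (F 0 t u) \<le> r'"
      and att: "(\<lambda>s::nat. SUP \<tau>\<in>I. semidist ?M (\<phi> 0 (\<tau> + int s) \<tau> ` (\<Union>n. K n)) (\<omega> 0)) \<longlonglongrightarrow> 0"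
      and L: "\<forall>t\<in>I. \<forall>r>0. nonneg_kernel \<Omega> (L t r) \<and>
           (\<forall>x\<in>\<Omega>. \<forall>y\<in>\<Omega>. \<forall>z\<in>Z \<inter> cball 0 r. \<forall>z'\<in>Z \<inter> cball 0 r.
              norm (f t x y z - f t x y z') \<le> L t r x y * norm (z - z'))"
        "\<forall>r>0. (SUP t\<in>I. kernel_sup \<Omega> (L t r)) < \<infinity>"
      and conv: "convergent_discretization \<Omega> I U F"
    for L :: "int \<Rightarrow> real \<Rightarrow> real^'k \<Rightarrow> real^'k \<Rightarrow> real"
  proof -
    have KU: "K n \<subseteq> U" for n
      using asym_compact[of n] by (simp add: strongly_asymptotically_compact_def)
    obtain k where k: "\<And>w. w \<in> (\<Union>n. K n) \<Longrightarrow> sup_norm \<Omega> w \<le> k"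
      using K by (auto simp: norm_bounded_def)
    have bdd: "\<exists>r'. \<forall>t\<in>I. \<forall>u\<in>U. sup_norm \<Omega> u \<le> r \<longrightarrow> sup_norm \<Omega> (F 0 t u) \<le> r'" for r
    proof -
      obtain r' where "\<forall>t\<in>I. \<forall>u\<in>U. sup_norm \<Omega> u \<le> max r 1 \<longrightarrow> sup_norm \<Omega> (F 0 t u) \<le> r'"
        using F_bdd[rule_format, of "max r 1", OF max.strict_coboundedI2[OF zero_less_one]] by blast
      then have "\<forall>t\<in>I. \<forall>u\<in>U. sup_norm \<Omega> u \<le> r \<longrightarrow> sup_norm \<Omega> (F 0 t u) \<le> r'"
        by (simp add: le_max_iff_disj)
      then show ?thesis by blast
    qed
    have lip: "\<exists>l\<ge>0. \<forall>t\<in>I. \<forall>u\<in>U. \<forall>v\<in>U. sup_norm \<Omega> u \<le> r0 \<longrightarrow> sup_norm \<Omega> v \<le> r0 \<longrightarrow>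
        mdist ?M (F 0 t u) (F 0 t v) \<le> l * mdist ?M u v" for r0
    proof -
      define r where "r = max r0 1"
      have r: "r > 0" "r0 \<le> r" by (simp_all add: r_def)
      have "(SUP t\<in>I. kernel_sup \<Omega> (L t r)) < top" using L(2) r by simp
      then obtain l where l: "0 \<le> l" "(SUP t\<in>I. kernel_sup \<Omega> (L t r)) = ennreal l"
        using less_top_ennreal by blast
      have "mdist ?M (F 0 t u) (F 0 t v) \<le> l * mdist ?M u v"
        if t: "t \<in> I" and u: "u \<in> U" "sup_norm \<Omega> u \<le> r0" and v: "v \<in> U" "sup_norm \<Omega> v \<le> r0" for t u v
      proof -
        have ker: "nonneg_kernel \<Omega> (L t r)" using L(1) t r by blast
        have sup: "kernel_sup \<Omega> (L t r) \<le> ennreal l"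
          unfolding l(2)[symmetric] using t by (rule SUP_upper)
        have zero: "nonneg_kernel \<Omega> (\<lambda>x y. 0)" "kernel_sup \<Omega> (\<lambda>x y. 0) \<le> ennreal 0"
          using \<Omega>(2) by (simp_all add: nonneg_kernel_def kernel_sup_def)
        have duv: "mdist ?M u v = sup_norm \<Omega> (\<lambda>x. u x - v x)"
          by (rule mdist_cont_space[OF \<Omega>(2) subsetD[OF UM u(1)] subsetD[OF UM v(1)]])
        have "norm (F 0 t u x - F 0 t v x) \<le> l * mdist ?M u v" if x: "x \<in> \<Omega>" for x
        proof -
          have "norm (LINT y|lebesgue_on \<Omega>. f t x y (u y) - f t x y (v y)) \<le> 0 + l * mdist ?M u v"
          proof (rule norm_integral_le_affine_kernels[OF _ ker zero(1) sup zero(2) l(1) _ _ x])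
            show "integrable (lebesgue_on \<Omega>) (\<lambda>y. f t x y (u y) - f t x y (v y))"
              using h_int[OF t _ x] u v by simp
            fix y assume y: "y \<in> \<Omega>"
            have "norm (u y - v y) \<le> mdist ?M u v"
              unfolding duv
              by (rule norm_le_sup_norm[OF \<Omega>(1) continuous_on_diff[OF cU[OF u(1)] cU[OF v(1)]] y])
            moreover have "0 \<le> L t r x y" using ker x y by (simp add: nonneg_kernel_def)
            ultimately have "L t r x y * norm (u y - v y) \<le> L t r x y * mdist ?M u v"
              by (rule mult_left_mono)
            moreover have "u y \<in> Z \<inter> cball 0 r" "v y \<in> Z \<inter> cball 0 r"
              using norm_le_sup_norm[OF \<Omega>(1) cU[OF u(1)] y] norm_le_sup_norm[OF \<Omega>(1) cU[OF v(1)] y]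
                u v y r(2) by (auto simp: U)
            then have "norm (f t x y (u y) - f t x y (v y)) \<le> L t r x y * norm (u y - v y)"
              using L(1) t r(1) x y by blast
            ultimately show "norm (f t x y (u y) - f t x y (v y)) \<le> 0 + L t r x y * mdist ?M u v"
              by simp
          qed simp_all
          then show ?thesis
            using h_int[OF t _ x] u v x by (simp add: F0 integral_op_def)
        qed
        then have "sup_norm \<Omega> (\<lambda>x. F 0 t u x - F 0 t v x) \<le> l * mdist ?M u v"
          by (rule sup_norm_le[OF \<Omega>(2)])
        moreover have "mdist ?M (F 0 t u) (F 0 t v) = sup_norm \<Omega> (\<lambda>x. F 0 t u x - F 0 t v x)"
          by (rule mdist_cont_space[OF \<Omega>(2) subsetD[OF UM F0U[OF t u(1)]]
                subsetD[OF UM F0U[OF t v(1)]]])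
        ultimately show ?thesis by simp
      qed
      then show ?thesis using l(1) by blast
    qed
    have conv': "\<forall>\<^sub>F n in sequentially. \<forall>t\<in>I. \<forall>u\<in>V. mdist ?M (F n t u) (F 0 t u) < e"
      if "e > 0" for e
    proof -
      have "norm_bounded \<Omega> V" by (auto simp: norm_bounded_def V_def)
      then obtain \<Gamma> C where \<Gamma>: "(\<Gamma> \<longlongrightarrow> 0) (at_right (0::real))"
        and C: "\<forall>n\<ge>1. \<forall>t\<in>I. \<forall>u\<in>V. mdist ?M (F n t u) (F 0 t u) \<le> C * \<Gamma> (1 / real n)"
        using conv VU unfolding convergent_discretization_def by blast
      have "filterlim (\<lambda>n. 1 / real n) (at_right 0) sequentially"
        unfolding filterlim_at
        by (auto intro!: lim_1_over_n eventually_sequentiallyI[of 1])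
      then have "(\<lambda>n. C * \<Gamma> (1 / real n)) \<longlonglongrightarrow> C * 0"
        by (intro tendsto_intros filterlim_compose[OF \<Gamma>])
      then have "\<forall>\<^sub>F n in sequentially. C * \<Gamma> (1 / real n) < e"
        using that by (intro order_tendstoD(2)) auto
      with eventually_ge_at_top[of 1] show ?thesis
      proof eventually_elim
        case (elim n)
        then show ?case using C by (meson le_less_trans)
      qed
    qed
    have close: "\<exists>\<delta>>0. \<forall>\<^sub>F n in sequentially. \<forall>t\<in>I. \<forall>w\<in>V. \<forall>w'\<in>(\<Union>n. K n). mdist ?M w w' < \<delta> \<longrightarrow>
      mdist ?M (iterate_steps (F n) t T w) (iterate_steps (F 0) t T w') < e" if e: "e > 0" for e T
    proof -
      have c: "sup_norm \<Omega> u \<le> \<rho> * R \<tau>0" if "u \<in> V" for u using that by (simp add: V_def)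
      obtain \<delta> where "\<delta> > 0" and ev: "\<forall>\<^sub>F n in sequentially. \<forall>t\<in>I. \<forall>w\<in>V. \<forall>w'\<in>U.
          sup_norm \<Omega> w' \<le> k \<longrightarrow> mdist ?M w w' < \<delta> \<longrightarrow>
          mdist ?M (iterate_steps (F n) t T w) (iterate_steps (F 0) t T w') < e"
        using iterate_steps_close[where N = "sup_norm \<Omega>" and G = F and r = k and s = T,
            OF up UM FU VU c FV bdd lip conv' e] by blast
      from ev have "\<forall>\<^sub>F n in sequentially. \<forall>t\<in>I. \<forall>w\<in>V. \<forall>w'\<in>(\<Union>n. K n). mdist ?M w w' < \<delta> \<longrightarrow>
          mdist ?M (iterate_steps (F n) t T w) (iterate_steps (F 0) t T w') < e"
      proof (rule eventually_mono)
        fix n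
        assume *: "\<forall>t\<in>I. \<forall>w\<in>V. \<forall>w'\<in>U. sup_norm \<Omega> w' \<le> k \<longrightarrow> mdist ?M w w' < \<delta> \<longrightarrow>
          mdist ?M (iterate_steps (F n) t T w) (iterate_steps (F 0) t T w') < e"
        show "\<forall>t\<in>I. \<forall>w\<in>V. \<forall>w'\<in>(\<Union>n. K n). mdist ?M w w' < \<delta> \<longrightarrow>
          mdist ?M (iterate_steps (F n) t T w) (iterate_steps (F 0) t T w') < e"
        proof (intro ballI impI)
          fix t w w' assume "t \<in> I" "w \<in> V" "w' \<in> (\<Union>n. K n)" "mdist ?M w w' < \<delta>"
          moreover from this have "w' \<in> U" using KU by blast
          ultimately show "mdist ?M (iterate_steps (F n) t T w) (iterate_steps (F 0) t T w') < e"
            using * k by blast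
        qed
      qed
      then show ?thesis using \<open>\<delta> > 0\<close> by blast
    qed
    have W: "\<omega> 0 \<subseteq> mspace ?M" using props(1)[of 0] KU UM unfolding \<omega>_def by blast
    have att': "(\<lambda>s. SUP \<tau>\<in>I. semidist ?M (iterate_steps (F 0) \<tau> s ` (\<Union>n. K n)) (\<omega> 0)) \<longlonglongrightarrow> 0"
      using att by (simp only: \<phi>_def general_solution_steps)
    have "(\<lambda>n. semidist ?M (forward_limit_set ?M I (F n) \<A>) (\<omega> 0)) \<longlonglongrightarrow> 0"
      by (rule forward_limit_set_perturbation[where G = F, OF up UM FU VU FV fib asym_compact W att' close])
    then show ?thesis by (simp only: \<omega>_def)
  qed

  show ?thesis
  proof (intro conjI allI ballI impI)
    fix n
    show "\<omega> n \<subseteq> K n" "\<omega> n \<noteq> {}" "compactin (mtopology_of ?M) (\<omega> n)"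
      "forward_attracts ?M I (F n) (\<omega> n) \<A>"
      unfolding \<omega>_def by (rule props)+
  next
    show "R \<tau> = R \<tau>'" if "\<tau> \<in> I" "\<tau>' \<in> I" for \<tau> \<tau>' using R_const that .
  qed (elim conjE exE, rule main)
qed

end
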